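(* The space $\mathfrak M\mathrm{MR}$ is a bialgebra with product $\bullet$, coproduct $\vartriangle$, unit $\eta$, and counit $\varepsilon$.
   Context: A set composition of a finite set $S$ of positive integers is a word $w=w_1\cdots w_k$ of nonempty pairwise disjoint sets with union $S$. An $\mathfrak M$-permutation of $[n]$ is a set composition $w=w_1\cdots w_k$ of $[n]$ such that no $w_i$ contains two consecutive integers; $\ell(w)=k$. $S^{\mathfrak M}_n$ is the set of these, $S^{\mathfrak M}_0=\{\emptyset\}$ (the empty $\mathfrak M$-permutation), $S^{\mathfrak M}_\infty=\bigcup_n S^{\mathfrak M}_n$. $\mathfrak M\mathrm{MR}=\bigoplus_{w\in S^{\mathfrak M}_\infty}\mathbb Z w$ (finite linear combinations). Standardization: for a set composition $w$ of $S$, $\mathrm{st}(w)\in S^{\mathfrak M}_\infty$ is obtained by repeating the following until an $\mathfrak M$-permutation results: (R1) delete the letter $i+1$ if both $i$ and $i+1$ belong to some $w_j$; (R2) reduce all letters larger than $i$ by $1$ if the positive integer $i$ is not present in any $w_j$. Restriction: for $T\subset S$, $w|_T$ is obtained by intersecting each $w_i$ with $T$ and removing the sets that become empty. Product: for $w\in S^{\mathfrak M}_m$, $u\in S^{\mathfrak M}_n$, $w\bullet u=\sum v$, over (1) all $v\in S^{\mathfrak M}_{m+n}$ with $v|_{[m]}=w$ and $\mathrm{st}(v|_{[m+1,m+n]})=u$; and (2) all $v\in S^{\mathfrak M}_{m+n-1}$ with $v|_{[m]}=w$ and $\mathrm{st}(v|_{[m,m+n-1]})=u$; extended bilinearly.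 Coproduct: $\vartriangle w=\sum_{[u,v]=w}\mathrm{st}(u)\otimes\mathrm{st}(v)$, over all pairs $(u,v)$ of (possibly empty) set compositions whose concatenation is $w$; extended linearly. Unit: $\eta(1)=\emptyset$. Counit: $\varepsilon$ takes the coefficient of $\emptyset$. *)

theory Defs
  imports Complex_Main "HOL-Library.Poly_Mapping" "HOL-Library.Disjoint_Sets"
begin

section \<open>Bialgebras on free abelian groups\<close>

text \<open>
  The type \<open>'a \<Rightarrow>\<^sub>0 int\<close> is the free abelian group on \<open>'a\<close>. The tensor product over the integers
  of the free groups on \<open>'a\<close> and \<open>'b\<close> is realised as the free group on \<open>'a \<times> 'b\<close>, the basis
  element \<open>(a, b)\<close> standing for the pure tensor of \<open>a\<close> and \<open>b\<close>; see \<open>tensor_universal\<close> below.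
  A map of abelian groups is linear over the integers iff it is additive.
\<close>

definition biadditive :: "('a::ab_group_add \<Rightarrow> 'b::ab_group_add \<Rightarrow> 'c::ab_group_add) \<Rightarrow> bool" where
  "biadditive f \<longleftrightarrow> (\<forall>y. additive (\<lambda>x. f x y)) \<and> (\<forall>x. additive (f x))"

definition tensor :: "('a \<Rightarrow>\<^sub>0 int) \<Rightarrow> ('b \<Rightarrow>\<^sub>0 int) \<Rightarrow> ('a \<times> 'b \<Rightarrow>\<^sub>0 int)" where
  "tensor x y = frag_extend (\<lambda>a. frag_extend (\<lambda>b. frag_of (a, b)) y) x"

definition tensor_map ::
  "(('a \<Rightarrow>\<^sub>0 int) \<Rightarrow> ('c \<Rightarrow>\<^sub>0 int)) \<Rightarrow> (('b \<Rightarrow>\<^sub>0 int) \<Rightarrow> ('d \<Rightarrow>\<^sub>0 int)) \<Rightarrow>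
    ('a \<times> 'b \<Rightarrow>\<^sub>0 int) \<Rightarrow> ('c \<times> 'd \<Rightarrow>\<^sub>0 int)" where
  "tensor_map f g = frag_extend (\<lambda>(a, b). tensor (f (frag_of a)) (g (frag_of b)))"

definition tensor_assoc :: "(('a \<times> 'b) \<times> 'c \<Rightarrow>\<^sub>0 int) \<Rightarrow> ('a \<times> 'b \<times> 'c \<Rightarrow>\<^sub>0 int)" where
  "tensor_assoc = frag_extend (\<lambda>((a, b), c). frag_of (a, b, c))"

text \<open>A functional on one tensor factor, followed by the identification of the tensor product
  of the integers with \<open>M\<close> (on either side) with \<open>M\<close>.\<close>

definition apply_left :: "(('a \<Rightarrow>\<^sub>0 int) \<Rightarrow> int) \<Rightarrow> ('a \<times> 'b \<Rightarrow>\<^sub>0 int) \<Rightarrow> ('b \<Rightarrow>\<^sub>0 int)" where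
  "apply_left e = frag_extend (\<lambda>(a, b). frag_cmul (e (frag_of a)) (frag_of b))"

definition apply_right :: "(('b \<Rightarrow>\<^sub>0 int) \<Rightarrow> int) \<Rightarrow> ('a \<times> 'b \<Rightarrow>\<^sub>0 int) \<Rightarrow> ('a \<Rightarrow>\<^sub>0 int)" where
  "apply_right e = frag_extend (\<lambda>(a, b). frag_cmul (e (frag_of b)) (frag_of a))"

text \<open>The product of the tensor square of an algebra.\<close>

definition tensor_mult ::
  "(('a \<Rightarrow>\<^sub>0 int) \<Rightarrow> ('a \<Rightarrow>\<^sub>0 int) \<Rightarrow> ('a \<Rightarrow>\<^sub>0 int)) \<Rightarrow>
    ('a \<times> 'a \<Rightarrow>\<^sub>0 int) \<Rightarrow> ('a \<times> 'a \<Rightarrow>\<^sub>0 int) \<Rightarrow> ('a \<times> 'a \<Rightarrow>\<^sub>0 int)" where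
  "tensor_mult m s t =
    frag_extend (\<lambda>(a, b). frag_extend (\<lambda>(c, d).
      tensor (m (frag_of a) (frag_of c)) (m (frag_of b) (frag_of d))) t) s"

locale Z_algebra =
  fixes mult :: "('a \<Rightarrow>\<^sub>0 int) \<Rightarrow> ('a \<Rightarrow>\<^sub>0 int) \<Rightarrow> ('a \<Rightarrow>\<^sub>0 int)"
    and unit :: "int \<Rightarrow> ('a \<Rightarrow>\<^sub>0 int)"
  assumes mult_biadditive: "biadditive mult"
    and unit_additive: "additive unit"
    and mult_assoc: "mult (mult x y) z = mult x (mult y z)"
    and mult_unit_left: "mult (unit 1) x = x"
    and mult_unit_right: "mult x (unit 1) = x"

locale Z_coalgebra =
  fixes comult :: "('a \<Rightarrow>\<^sub>0 int) \<Rightarrow> ('a \<times> 'a \<Rightarrow>\<^sub>0 int)"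
    and counit :: "('a \<Rightarrow>\<^sub>0 int) \<Rightarrow> int"
  assumes comult_additive: "additive comult"
    and counit_additive: "additive counit"
    and comult_coassoc: "tensor_assoc (tensor_map comult id (comult x)) = tensor_map id comult (comult x)"
    and counit_left: "apply_left counit (comult x) = x"
    and counit_right: "apply_right counit (comult x) = x"

locale Z_bialgebra =
  Z_algebra mult unit + Z_coalgebra comult counit
  for mult :: "('a \<Rightarrow>\<^sub>0 int) \<Rightarrow> ('a \<Rightarrow>\<^sub>0 int) \<Rightarrow> ('a \<Rightarrow>\<^sub>0 int)"
    and unit :: "int \<Rightarrow> ('a \<Rightarrow>\<^sub>0 int)"
    and comult :: "('a \<Rightarrow>\<^sub>0 int) \<Rightarrow> ('a \<times> 'a \<Rightarrow>\<^sub>0 int)"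
    and counit :: "('a \<Rightarrow>\<^sub>0 int) \<Rightarrow> int" +
  assumes comult_mult: "comult (mult x y) = tensor_mult mult (comult x) (comult y)"
    and comult_unit: "comult (unit 1) = tensor (unit 1) (unit 1)"
    and counit_mult: "counit (mult x y) = counit x * counit y"
    and counit_unit: "counit (unit 1) = 1"

lemma tensor_frag_of [simp]: "tensor (frag_of a) (frag_of b) = frag_of (a, b)"
  by (simp add: tensor_def)

lemma additive_frag_extend: "additive (frag_extend f)"
  by (simp add: additive_def frag_extend_add)

lemma frag_extend_fun_add: "frag_extend (\<lambda>a. f a + g a) x = frag_extend f x + frag_extend g x"
  by (simp add: frag_extend_def frag_cmul_distrib2 sum.distrib)

lemma tensor_add_left: "tensor (x + x') y = tensor x y + tensor x' y"
  by (simp add: tensor_def frag_extend_add)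

lemma tensor_add_right: "tensor x (y + y') = tensor x y + tensor x y'"
  by (simp add: tensor_def frag_extend_add frag_extend_fun_add)

lemma biadditive_tensor: "biadditive tensor"
  by (simp add: biadditive_def additive_def tensor_add_left tensor_add_right)

lemma additive_eqI:
  fixes f g :: "('a \<Rightarrow>\<^sub>0 int) \<Rightarrow> 'b::ab_group_add"
  assumes "additive f" "additive g" "\<And>a. f (frag_of a) = g (frag_of a)"
  shows "f x = g x"
proof -
  interpret f: additive f by fact
  interpret g: additive g by fact
  have "Poly_Mapping.keys x \<subseteq> UNIV" by simp
  then show ?thesis
    by (induction x rule: frag_induction) (auto simp: f.zero g.zero f.diff g.diff assms(3))
qed

lemma tensor_universal:
  fixes f :: "('a \<Rightarrow>\<^sub>0 int) \<Rightarrow> ('b \<Rightarrow>\<^sub>0 int) \<Rightarrow> ('c \<Rightarrow>\<^sub>0 int)"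
  assumes f: "biadditive f"
  shows "\<exists>!g. additive g \<and> (\<forall>x y. g (tensor x y) = f x y)"
proof -
  define g where "g = frag_extend (\<lambda>(a, b). f (frag_of a) (frag_of b))"
  have g: "additive g"
    by (simp add: g_def additive_frag_extend)
  have fl: "additive (\<lambda>x. f x y)" and fr: "additive (f x)" for x y
    using f by (auto simp: biadditive_def)
  have gl: "additive (\<lambda>x. g (tensor x y))" and gr: "additive (\<lambda>y. g (tensor x y))" for x y
    using g by (auto simp: additive_def tensor_add_left tensor_add_right)
  have "g (tensor (frag_of a) y) = f (frag_of a) y" for a y
    by (rule additive_eqI[OF gr fr]) (simp add: g_def)
  then have gf: "g (tensor x y) = f x y" for x y
    by (rule additive_eqI[OF gl fl])
  show ?thesis
  proof (rule ex1I[of _ g])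
    show "additive g \<and> (\<forall>x y. g (tensor x y) = f x y)"
      using g gf by blast
  next
    fix h assume h: "additive h \<and> (\<forall>x y. h (tensor x y) = f x y)"
    have *: "h (frag_of c) = g (frag_of c)" for c
      using h gf tensor_frag_of[of "fst c" "snd c"] by (metis prod.collapse)
    have "h z = g z" for z
      by (rule additive_eqI) (use g h * in auto)
    then show "h = g" by (rule ext)
  qed
qed


section \<open>Multi-permutations\<close>

definition set_composition :: "nat set \<Rightarrow> nat set list \<Rightarrow> bool" where
  "set_composition S w \<longleftrightarrow>
    finite S \<and> 0 \<notin> S \<and> {} \<notin> set w \<and>
    disjoint_family_on (\<lambda>i. w ! i) {..<length w} \<and> \<Union>(set w) = S"

definition M_perms :: "nat \<Rightarrow> nat set list set" where
  "M_perms n = {w. set_composition {1..n} w \<and> (\<forall>B\<in>set w. \<forall>i. \<not> (i \<in> B \<and> Suc i \<in> B))}"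

typedef mperm = "\<Union>n. M_perms n"
  morphisms blocks MPerm
proof
  have "[] \<in> M_perms 0"
    by (simp add: M_perms_def set_composition_def disjoint_family_on_def)
  then show "[] \<in> (\<Union>n. M_perms n)" by blast
qed

definition empty_mperm :: mperm where
  "empty_mperm = MPerm []"

text \<open>The number \<open>n\<close> such that \<open>w\<close> is a multi-permutation of \<open>{1..n}\<close>.\<close>

definition deg :: "mperm \<Rightarrow> nat" where
  "deg w = card (\<Union>(set (blocks w)))"

lemma blocks_in_M_perms_iff: "blocks w \<in> M_perms n \<longleftrightarrow> deg w = n"
proof -
  obtain k where "blocks w \<in> M_perms k"
    using blocks[of w] by blast
  then show ?thesis
    by (auto simp: M_perms_def set_composition_def deg_def)
qed

text \<open>One application of (R1) or (R2). An instance of (R2) with \<open>i\<close> above all letters changes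
  nothing, so multi-permutations admit no other step than the trivial one.\<close>

inductive st_step :: "nat set list \<Rightarrow> nat set list \<Rightarrow> bool" where
  R1: "B \<in> set w \<Longrightarrow> i \<in> B \<Longrightarrow> Suc i \<in> B \<Longrightarrow> st_step w (map (\<lambda>A. A - {Suc i}) w)"
| R2: "0 < i \<Longrightarrow> i \<notin> \<Union>(set w) \<Longrightarrow>
        st_step w (map (\<lambda>A. (\<lambda>x. if x > i then x - 1 else x) ` A) w)"

definition st :: "nat set list \<Rightarrow> mperm" where
  "st w = (THE v. st_step\<^sup>*\<^sup>* w (blocks v))"

definition restr :: "nat set list \<Rightarrow> nat set \<Rightarrow> nat set list" where
  "restr w T = filter (\<lambda>A. A \<noteq> {}) (map (\<lambda>A. A \<inter> T) w)"

text \<open>The index set of the product \<open>w \<bullet> u\<close>. The equation \<open>deg v + 1 = m + n\<close> expresses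
  \<open>deg v = m + n - 1\<close> over the integers, so that there is no such \<open>v\<close> when \<open>m = n = 0\<close>.\<close>

definition prod_terms :: "mperm \<Rightarrow> mperm \<Rightarrow> mperm set" where
  "prod_terms w u = (let m = deg w; n = deg u in
    {v. deg v = m + n \<and> restr (blocks v) {1..m} = blocks w \<and>
        st (restr (blocks v) {m + 1..m + n}) = u} \<union>
    {v. deg v + 1 = m + n \<and> restr (blocks v) {1..m} = blocks w \<and>
        st (restr (blocks v) {m..m + n - 1}) = u})"

type_synonym MMR = "mperm \<Rightarrow>\<^sub>0 int"

definition MMR_mult :: "MMR \<Rightarrow> MMR \<Rightarrow> MMR" where
  "MMR_mult x y =
    frag_extend (\<lambda>w. frag_extend (\<lambda>u. \<Sum>v\<in>prod_terms w u. frag_of v) y) x"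

definition MMR_comult :: "MMR \<Rightarrow> (mperm \<times> mperm \<Rightarrow>\<^sub>0 int)" where
  "MMR_comult = frag_extend (\<lambda>w. \<Sum>(u, v) | u @ v = blocks w. tensor (frag_of (st u)) (frag_of (st v)))"

definition MMR_unit :: "int \<Rightarrow> MMR" where
  "MMR_unit c = frag_cmul c (frag_of empty_mperm)"

definition MMR_counit :: "MMR \<Rightarrow> int" where
  "MMR_counit x = Poly_Mapping.lookup x empty_mperm"

text \<open>The sums above range over finite sets.\<close>

lemma finite_deg: "finite {v. deg v = n}"
proof -
  have "distinct w" if "w \<in> M_perms n" for w
  proof -
    have "w ! i \<noteq> w ! j" if "i < length w" "j < length w" "i \<noteq> j" for i j
    proof -
      have "w ! i \<inter> w ! j = {}" "w ! i \<noteq> {}"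
        using \<open>w \<in> M_perms n\<close> that nth_mem[of i w]
        by (auto simp: M_perms_def set_composition_def disjoint_family_on_def simp del: nth_mem)
      then show ?thesis by auto
    qed
    then show ?thesis by (simp add: distinct_conv_nth)
  qed
  then have "M_perms n \<subseteq> {w. set w \<subseteq> Pow {1..n} \<and> distinct w}"
    by (auto simp: M_perms_def set_composition_def)
  moreover have "finite {w. set w \<subseteq> Pow {1..n} \<and> distinct w}"
    by (rule finite_subset_distinct) simp
  ultimately have "finite (M_perms n)"
    by (rule finite_subset)
  then have "finite (blocks -` M_perms n)"
    by (rule finite_vimageI) (simp add: inj_on_def blocks_inject)
  then show ?thesis
    by (simp add: vimage_def blocks_in_M_perms_iff)
qed

lemma finite_prod_terms: "finite (prod_terms w u)"
proof (rule finite_subset)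
  show "prod_terms w u \<subseteq> {v. deg v = deg w + deg u} \<union> {v. deg v = deg w + deg u - 1}"
    by (auto simp: prod_terms_def Let_def)
qed (simp add: finite_deg)

lemma finite_deconcatenations: "finite {(u, v). u @ v = w}"
proof (rule finite_subset)
  show "{(u, v). u @ v = w} \<subseteq> (\<lambda>k. (take k w, drop k w)) ` {..length w}"
  proof clarify
    fix u v assume "w = u @ v"
    then show "(u, v) \<in> (\<lambda>k. (take k (u @ v), drop k (u @ v))) ` {..length (u @ v)}"
      by (intro image_eqI[of _ _ "length u"]) auto
  qed
qed simp

end

(* A map f that is weakly increasing on the letters of a set composition w and identifies only
   letters of a common block collapses w to the set composition of the images of its blocks.
   Both (R1) and (R2) are of this kind, collapsing maps compose, and there is exactly one
   collapse of w that is a multi-permutation; hence st w is this collapse, and st is invariant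
   under collapsing.

   If all letters of w are smaller than those of u, the product of st w and st u is the sum of
   st v over the quasi-shuffles v of w and u, that is, over the set compositions v of the union
   of the letters whose restrictions are w and u: a term of the product has a unique preimage v
   under the two collapses, and the terms of degree m + n - 1 arise when the largest letter of w
   and the smallest letter of u are identified. Likewise the coproduct of st w is obtained by
   cutting w itself. Quasi-shuffling is associative, since both bracketings amount to prescribing
   three restrictions, and it is compatible with cutting. *)

theory Submission
  imports Defs
begin

section \<open>Set compositions and restriction\<close>

abbreviation letters :: "nat set list \<Rightarrow> nat set" where
  "letters w \<equiv> \<Union>(set w)"

text \<open>The ground set is read off from the word itself, so that being a set composition becomes
  a property of \<open>w\<close> alone and can be unfolded along \<open>#\<close> and
  \<open>@\<close>.\<close>

definition scomp :: "nat set list \<Rightarrow> bool" where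
  "scomp w \<longleftrightarrow> set_composition (letters w) w"

lemma scomp_Nil [simp]: "scomp []"
  by (simp add: scomp_def set_composition_def disjoint_family_on_def)

text \<open>Trades disjointness of indexed positions for a recursive condition, which makes
  induction over the list of blocks available.\<close>

lemma disjoint_family_on_Cons:
  "disjoint_family_on (\<lambda>i. (A # w) ! i) {..<length (A # w)} \<longleftrightarrow>
    A \<inter> letters w = {} \<and> disjoint_family_on (\<lambda>i. w ! i) {..<length w}"
proof -
  have "A \<inter> letters w = {} \<longleftrightarrow> (\<forall>B\<in>set w. A \<inter> B = {})"
    by blast
  then have "A \<inter> letters w = {} \<longleftrightarrow> (\<forall>i<length w. A \<inter> w ! i = {})"
    unfolding all_set_conv_all_nth .
  moreover have "disjoint_family_on (\<lambda>i. (A # w) ! i) {..<length (A # w)} \<longleftrightarrow>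
    (\<forall>i<Suc (length w). \<forall>j<Suc (length w). i \<noteq> j \<longrightarrow> (A # w) ! i \<inter> (A # w) ! j = {})"
    by (simp add: disjoint_family_on_def Ball_def)
  moreover have "\<dots> \<longleftrightarrow> (\<forall>i<length w. A \<inter> w ! i = {}) \<and>
    (\<forall>i<length w. \<forall>j<length w. i \<noteq> j \<longrightarrow> w ! i \<inter> w ! j = {})"
    by (simp add: All_less_Suc2 Int_commute[of _ A]) (meson)
  moreover have "disjoint_family_on (\<lambda>i. w ! i) {..<length w} \<longleftrightarrow>
    (\<forall>i<length w. \<forall>j<length w. i \<noteq> j \<longrightarrow> w ! i \<inter> w ! j = {})"
    by (simp add: disjoint_family_on_def Ball_def)
  ultimately show ?thesis by metis
qed

lemma scomp_Cons [simp]: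
  "scomp (A # w) \<longleftrightarrow> finite A \<and> 0 \<notin> A \<and> A \<noteq> {} \<and> A \<inter> letters w = {} \<and> scomp w"
  unfolding scomp_def set_composition_def disjoint_family_on_Cons by auto

lemma scomp_append [simp]:
  "scomp (u @ v) \<longleftrightarrow> scomp u \<and> scomp v \<and> letters u \<inter> letters v = {}"
  by (induction u) auto

lemma scomp_finite: "scomp w \<Longrightarrow> finite (letters w)"
  and scomp_zero: "scomp w \<Longrightarrow> 0 \<notin> letters w"
  by (auto simp: scomp_def set_composition_def)

lemma scomp_disjoint:
  "scomp w \<Longrightarrow> A \<in> set w \<Longrightarrow> B \<in> set w \<Longrightarrow> x \<in> A \<Longrightarrow> x \<in> B \<Longrightarrow> A = B"
  by (induction w) auto

lemma restr_Nil [simp]: "restr [] T = []"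
  by (simp add: restr_def)

lemma restr_Cons [simp]:
  "restr (A # w) T = (if A \<inter> T = {} then restr w T else (A \<inter> T) # restr w T)"
  by (simp add: restr_def)

lemma restr_append [simp]: "restr (u @ v) T = restr u T @ restr v T"
  by (simp add: restr_def)

lemma letters_restr [simp]: "letters (restr w T) = letters w \<inter> T"
  by (auto simp: restr_def)

lemma scomp_restr: "scomp w \<Longrightarrow> scomp (restr w T)"
proof (induction w)
  case (Cons A w)
  then have "A \<inter> T \<inter> letters (restr w T) = {}"
    by auto
  with Cons show ?case by auto
qed simp

lemma restr_restr [simp]: "restr (restr w T) U = restr w (T \<inter> U)"
  by (induction w) (auto simp: Int_assoc)

lemma restr_superset: "scomp w \<Longrightarrow> letters w \<subseteq> T \<Longrightarrow> restr w T = w"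
  by (induction w) (auto simp: Int_absorb2)

lemma restr_cong: "letters w \<inter> T = letters w \<inter> U \<Longrightarrow> restr w T = restr w U"
proof (induction w)
  case (Cons A w)
  then have "A \<inter> T = A \<inter> U" "letters w \<inter> T = letters w \<inter> U"
    by auto
  with Cons show ?case by simp
qed simp

lemma finite_scomp:
  assumes "finite S"
  shows "finite {w. scomp w \<and> letters w = S}"
proof (rule finite_subset)
  \<comment> \<open>Nonempty disjoint blocks cannot repeat, so only finitely many lists over
    \<open>Pow S\<close> qualify.\<close>
  have "distinct w" if "scomp w" for w
    using that by (induction w) auto
  then show "{w. scomp w \<and> letters w = S} \<subseteq> {w. set w \<subseteq> Pow S \<and> distinct w}"
    by auto
  show "finite {w. set w \<subseteq> Pow S \<and> distinct w}"
    by (rule finite_subset_distinct) (simp add: assms)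
qed


section \<open>Collapsing maps and standardization\<close>

text \<open>The last condition says that every fibre of \<open>f\<close> on the letters lies inside
  one block; this keeps the images of different blocks disjoint. Positivity prevents 0 from becoming
  a letter. Only the values of \<open>f\<close> on the letters are constrained.\<close>

definition collapsing :: "(nat \<Rightarrow> nat) \<Rightarrow> nat set list \<Rightarrow> bool" where
  "collapsing f w \<longleftrightarrow> mono_on (letters w) f \<and> (\<forall>x\<in>letters w. 0 < f x) \<and>
    (\<forall>A\<in>set w. \<forall>x\<in>A. \<forall>y\<in>letters w. f x = f y \<longrightarrow> y \<in> A)"

lemma collapsing_mono: "collapsing f w \<Longrightarrow> x \<in> letters w \<Longrightarrow> y \<in> letters w \<Longrightarrow> x \<le> y \<Longrightarrow> f x \<le> f y"
  by (auto simp: collapsing_def mono_on_def)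

lemma collapsing_pos: "collapsing f w \<Longrightarrow> x \<in> letters w \<Longrightarrow> 0 < f x"
  by (auto simp: collapsing_def)

lemma collapsing_kernel:
  "collapsing f w \<Longrightarrow> A \<in> set w \<Longrightarrow> x \<in> A \<Longrightarrow> y \<in> letters w \<Longrightarrow> f x = f y \<Longrightarrow> y \<in> A"
  unfolding collapsing_def by blast

lemma collapsing_subset:
  "collapsing f w \<Longrightarrow> set u \<subseteq> set w \<Longrightarrow> collapsing f u"
  unfolding collapsing_def
  by (intro conjI mono_on_subset[of "letters w" f "letters u"]) (elim conjE, blast)+

lemma letters_map: "letters (map ((`) f) w) = f ` letters w"
  by (simp add: image_Union)

lemma scomp_collapse: "scomp w \<Longrightarrow> collapsing f w \<Longrightarrow> scomp (map ((`) f) w)"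
proof (induction w)
  case (Cons A w)
  have "f x \<noteq> f y" if "x \<in> A" "y \<in> letters w" for x y
    using collapsing_kernel[OF Cons.prems(2), of A x y] Cons.prems(1) that by auto
  then have "f ` A \<inter> letters (map ((`) f) w) = {}"
    by auto
  moreover have "collapsing f w"
    using Cons.prems(2) by (rule collapsing_subset) auto
  moreover have "0 \<notin> f ` A"
    using collapsing_pos[OF Cons.prems(2)] by force
  ultimately show ?case
    using Cons by simp
qed simp

lemma collapsing_comp:
  assumes "collapsing f w" "collapsing g (map ((`) f) w)"
  shows "collapsing (g \<circ> f) w"
proof -
  have "g (f x) \<le> g (f y)" if "x \<in> letters w" "y \<in> letters w" "x \<le> y" for x y
    using collapsing_mono[OF assms(2), of "f x" "f y"] collapsing_mono[OF assms(1), of x y] that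
    by auto
  moreover have "0 < g (f x)" if "x \<in> letters w" for x
    using collapsing_pos[OF assms(2), of "f x"] that by auto
  moreover have "y \<in> A" if "A \<in> set w" "x \<in> A" "y \<in> letters w" "g (f x) = g (f y)" for A x y
  proof -
    have "f y \<in> f ` A"
      using collapsing_kernel[OF assms(2), of "f ` A" "f x" "f y"] that by auto
    then obtain z where "z \<in> A" "f z = f y" by auto
    then show ?thesis
      using collapsing_kernel[OF assms(1), of A z y] that by auto
  qed
  ultimately show ?thesis
    unfolding collapsing_def mono_on_def by auto
qed

lemma map_image_cong:
  assumes "\<And>x. x \<in> letters w \<Longrightarrow> f x = g x"
  shows "map ((`) f) w = map ((`) g) w"
proof (intro map_cong image_cong refl)
  fix A x assume "A \<in> set w" "x \<in> A"
  then have "x \<in> letters w" by blast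
  then show "f x = g x" by (simp only: assms)
qed

lemma map_image_comp: "map ((`) g) (map ((`) f) w) = map ((`) (g \<circ> f)) w"
  by (simp add: image_comp)

lemma collapsing_id: "scomp w \<Longrightarrow> collapsing (\<lambda>x. x) w"
  using scomp_zero[of w] unfolding collapsing_def mono_on_def by (auto intro: gr0I)

text \<open>Images need not commute with intersections, but here they do: if a letter of a block
  \<open>A\<close> and a letter of \<open>T\<close> have the same image, the latter lies in
  \<open>A\<close> as well, because fibres stay within blocks.\<close>

lemma restr_collapse:
  assumes "collapsing f w" "T \<subseteq> letters w"
  shows "restr (map ((`) f) w) (f ` T) = map ((`) f) (restr w T)"
proof -
  have eq: "f ` A \<inter> f ` T = f ` (A \<inter> T)" if "A \<in> set w" for A
  proof -
    have "a \<in> A \<inter> T" if "x \<in> A" "a \<in> T" "f x = f a" for x a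
      using collapsing_kernel[OF assms(1) \<open>A \<in> set w\<close>, of x a] that assms(2) by auto
    then show ?thesis by blast
  qed
  have "\<forall>A\<in>set u. f ` A \<inter> f ` T = f ` (A \<inter> T) \<Longrightarrow>
      restr (map ((`) f) u) (f ` T) = map ((`) f) (restr u T)" for u
    by (induction u) auto
  from this[of w] show ?thesis using eq by simp
qed

lemma collapsing_restr:
  assumes "collapsing f w"
  shows "collapsing f (restr w T)"
proof -
  have "\<exists>B\<in>set w. A = B \<inter> T" if "A \<in> set (restr w T)" for A
    using that by (auto simp: restr_def)
  moreover have "mono_on (letters w \<inter> T) f"
    using assms by (auto simp: collapsing_def intro: mono_on_subset)
  ultimately show ?thesis
    using assms unfolding collapsing_def letters_restr by fast
qed

section \<open>Multi-permutations as reduced compositions, and the rewriting steps as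
  collapses\<close>

abbreviation reduced :: "nat set list \<Rightarrow> bool" where
  "reduced t \<equiv> t \<in> (\<Union>n. M_perms n)"

lemma scomp_blocks [simp]: "scomp (blocks t)"
  and letters_blocks: "letters (blocks t) = {1..deg t}"
  and reduced_blocks: "reduced (blocks t)"
proof -
  have *: "blocks t \<in> M_perms (deg t)"
    by (simp add: blocks_in_M_perms_iff)
  then have "set_composition {1..deg t} (blocks t)"
    by (simp add: M_perms_def)
  then show "scomp (blocks t)" "letters (blocks t) = {1..deg t}"
    by (auto simp: scomp_def set_composition_def)
  show "reduced (blocks t)"
    using * by blast
qed

lemma reduced_iff:
  "reduced t \<longleftrightarrow> scomp t \<and> (\<exists>n. letters t = {1..n}) \<and> (\<forall>B\<in>set t. \<forall>i. \<not> (i \<in> B \<and> Suc i \<in> B))"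
proof -
  have "set_composition {1..n} t \<longleftrightarrow> scomp t \<and> letters t = {1..n}" for n
    unfolding scomp_def set_composition_def by metis
  then show ?thesis
    by (simp add: M_perms_def)
qed

lemma reduced_obtain:
  assumes "reduced t"
  obtains v where "blocks v = t"
  using assms MPerm_inverse by blast

text \<open>Deleting \<open>Suc i\<close> amounts to sending it to \<open>i\<close>: the two letters
  share the block \<open>B\<close>, and by disjointness no other block contains either of
  them.\<close>

lemma collapsing_R1:
  assumes w: "scomp w" and B: "B \<in> set w" "i \<in> B" "Suc i \<in> B"
  defines "f \<equiv> \<lambda>x. if x = Suc i then i else x"
  shows "collapsing f w" "map (\<lambda>A. A - {Suc i}) w = map ((`) f) w"
proof -
  have i: "Suc i \<in> A \<longleftrightarrow> A = B" "i \<in> A \<longleftrightarrow> A = B" if "A \<in> set w" for A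
    using B that scomp_disjoint[OF w, of A B] by auto
  have "i \<noteq> 0"
    using B scomp_zero[OF w] by (cases i) auto
  have "A - {Suc i} = f ` A" if "A \<in> set w" for A
    using i[OF that] by (auto simp: f_def image_iff split: if_splits)
  then show "map (\<lambda>A. A - {Suc i}) w = map ((`) f) w"
    by simp
  show "collapsing f w"
    unfolding collapsing_def mono_on_def
  proof (intro conjI ballI allI impI)
    fix A x y assume A: "A \<in> set w" "x \<in> A" "y \<in> letters w" "f x = f y"
    then show "y \<in> A"
      using i[OF A(1)] by (auto simp: f_def split: if_splits)
  next
    fix x assume "x \<in> letters w"
    then show "0 < f x"
      using scomp_zero[OF w] \<open>i \<noteq> 0\<close> by (cases "x = 0") (auto simp: f_def)
  qed (auto simp: f_def)
qed

text \<open>The only two numbers identified by this map are \<open>i\<close> and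
  \<open>Suc i\<close>, and \<open>i\<close> is not a letter; so the map is injective on the
  letters.\<close>

lemma collapsing_R2:
  assumes w: "scomp w" and i: "0 < i" "i \<notin> letters w"
  shows "collapsing (\<lambda>x. if x > i then x - 1 else x) w" (is "collapsing ?f w")
  unfolding collapsing_def mono_on_def
proof (intro conjI ballI allI impI)
  fix A x y assume A: "A \<in> set w" "x \<in> A" "y \<in> letters w" "?f x = ?f y"
  have "x \<noteq> i" "y \<noteq> i" using A i by auto
  then have "x = y" using A(4) by (auto split: if_splits)
  with A show "y \<in> A" by simp
next
  fix x assume "x \<in> letters w"
  then show "0 < ?f x"
    using scomp_zero[OF w] i by (cases "x = 0") auto
qed auto

lemma st_step_collapsing:
  assumes "st_step w w'" "scomp w"
  shows "\<exists>f. collapsing f w \<and> w' = map ((`) f) w"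
  using assms
proof cases
  case (R1 B i)
  then show ?thesis
    using collapsing_R1[OF assms(2)] by blast
next
  case (R2 i)
  then show ?thesis
    using collapsing_R2[OF assms(2)] by blast
qed

lemma st_steps_collapsing:
  assumes "st_step\<^sup>*\<^sup>* w w'" "scomp w"
  shows "\<exists>f. collapsing f w \<and> w' = map ((`) f) w"
  using assms(1)
proof (induction rule: rtranclp_induct)
  case base
  show ?case
    by (rule exI[of _ "\<lambda>x. x"]) (simp add: collapsing_id[OF assms(2)])
next
  case (step y z)
  then obtain f where f: "collapsing f w" "y = map ((`) f) w" by blast
  obtain g where "collapsing g y" "z = map ((`) g) y"
    using st_step_collapsing[OF step(2)] scomp_collapse[OF assms(2) f(1)] f(2) by auto
  with f collapsing_comp[OF f(1), of g] map_image_comp[of g f w] show ?case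
    by auto
qed

section \<open>Termination of the rewriting process\<close>

lemma downclosed_interval:
  fixes S :: "nat set"
  assumes "finite S" "0 \<notin> S" "\<And>i x. 0 < i \<Longrightarrow> i \<le> x \<Longrightarrow> x \<in> S \<Longrightarrow> i \<in> S"
  shows "\<exists>n. S = {1..n}"
proof (cases "S = {}")
  case False
  have "S = {1..Max S}"
  proof (intro set_eqI iffI)
    fix x assume "x \<in> S"
    then show "x \<in> {1..Max S}"
      using assms(1,2) by (cases "x = 0") auto
  next
    fix x assume "x \<in> {1..Max S}"
    then show "x \<in> S"
      using assms(3)[of x "Max S"] Max_in[OF assms(1) False] by auto
  qed
  then show ?thesis by blast
qed (auto intro: exI[of _ 0])

text \<open>The sum of the letters serves as termination measure. A collapse that raises no letter
  and lowers at least one makes it drop, since merging letters can only decrease the sum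
  further.\<close>

lemma not_reduced_step:
  assumes "scomp w" "\<not> reduced w"
  shows "\<exists>w'. st_step w w' \<and> scomp w' \<and> \<Sum>(letters w') < \<Sum>(letters w)"
proof -
  have main: ?thesis if "st_step w (map ((`) f) w)" "collapsing f w"
    "\<forall>x\<in>letters w. f x \<le> x" "x \<in> letters w" "f x < x" for f x
  proof -
    have fin: "finite (letters w)"
      using assms(1) by (rule scomp_finite)
    have "\<Sum>(f ` letters w) \<le> sum f (letters w)"
      using sum_image_le[OF fin, of "\<lambda>x. x" f] by (simp add: o_def)
    also have "\<dots> < \<Sum>(letters w)"
      by (rule sum_strict_mono_ex1) (use fin that in auto)
    finally show ?thesis
      using that scomp_collapse[OF assms(1), of f] letters_map[of f w] by metis
  qed
  show ?thesis
  proof (cases "\<exists>B\<in>set w. \<exists>i. i \<in> B \<and> Suc i \<in> B")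
    case True
    then obtain B i where B: "B \<in> set w" "i \<in> B" "Suc i \<in> B" by blast
    have "st_step w (map ((`) (\<lambda>x. if x = Suc i then i else x)) w)"
      using st_step.R1[OF B] collapsing_R1(2)[OF assms(1) B] by simp
    then show ?thesis
      using collapsing_R1(1)[OF assms(1) B] by (rule main[where x = "Suc i"]) (use B in auto)
  next
    case False
    then have "\<nexists>n. letters w = {1..n}"
      using assms reduced_iff[of w] by auto
    \<comment> \<open>Without a gap below some letter, the letters would be downward closed and
      hence an initial interval. Having the letter \<open>x\<close> above the gap \<open>i\<close>
      excludes the trivial instance of (R2).\<close>
    then obtain i x where ix: "0 < i" "i \<le> x" "x \<in> letters w" "i \<notin> letters w"
      using downclosed_interval[OF scomp_finite[OF assms(1)] scomp_zero[OF assms(1)]] by blast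
    then have "i < x"
      by (cases "x = i") auto
    show ?thesis
      using st_step.R2[OF ix(1,4)] collapsing_R2[OF assms(1) ix(1,4)]
      by (rule main[where x = x]) (use ix \<open>i < x\<close> in auto)
  qed
qed

lemma st_steps_exist: "scomp w \<Longrightarrow> \<exists>v. st_step\<^sup>*\<^sup>* w (blocks v)"
proof (induction "\<Sum>(letters w)" arbitrary: w rule: less_induct)
  case less
  show ?case
  proof (cases "reduced w")
    case True
    then show ?thesis
      using reduced_obtain[of w] by (metis rtranclp.rtrancl_refl)
  next
    case False
    then obtain w' where "st_step w w'" "scomp w'" "\<Sum>(letters w') < \<Sum>(letters w)"
      using not_reduced_step[OF less.prems] by blast
    then show ?thesis
      using less.hyps[of w'] by (meson converse_rtranclp_into_rtranclp)
  qed
qed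

section \<open>Uniqueness of the reduced collapse\<close>

lemma card_image_kernel_le:
  assumes "finite S" "\<And>x y. x \<in> S \<Longrightarrow> y \<in> S \<Longrightarrow> g x = g y \<Longrightarrow> f x = f y"
  shows "card (f ` S) \<le> card (g ` S)"
proof -
  \<comment> \<open>On \<open>S\<close> the map \<open>f\<close> factors through \<open>g\<close>,
    by way of a chosen point in each fibre of \<open>g\<close>.\<close>
  have "f x = f (inv_into S g (g x))" if "x \<in> S" for x
    using assms(2)[of x "inv_into S g (g x)"] that
    by (metis f_inv_into_f image_eqI inv_into_into)
  then have "f ` S = (\<lambda>y. f (inv_into S g y)) ` g ` S"
    by (auto simp: image_iff)
  then show ?thesis
    by (metis assms(1) card_image_le finite_imageI)
qed

text \<open>The right-hand side does not mention the map: hence collapsing maps onto reduced compositions are unique.\<close>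

lemma collapsing_kernel_iff:
  assumes f: "collapsing f w" and r: "reduced (map ((`) f) w)"
    and xy: "x \<in> letters w" "y \<in> letters w" "x \<le> y"
  shows "f x = f y \<longleftrightarrow> (\<exists>A\<in>set w. letters w \<inter> {x..y} \<subseteq> A)"
proof
  assume eq: "f x = f y"
  obtain A where A: "A \<in> set w" "x \<in> A"
    using xy by blast
  have "z \<in> A" if "z \<in> letters w" "x \<le> z" "z \<le> y" for z
  proof -
    have "f x = f z"
      using collapsing_mono[OF f, of x z] collapsing_mono[OF f, of z y] that xy eq by auto
    then show ?thesis
      using collapsing_kernel[OF f A] that by blast
  qed
  then have "letters w \<inter> {x..y} \<subseteq> A"
    by (meson IntD1 IntD2 atLeastAtMost_iff subsetI)
  then show "\<exists>A\<in>set w. letters w \<inter> {x..y} \<subseteq> A"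
    using A(1) by (rule rev_bexI[rotated])
next
  assume "\<exists>A\<in>set w. letters w \<inter> {x..y} \<subseteq> A"
  then obtain A where A: "A \<in> set w" "letters w \<inter> {x..y} \<subseteq> A" by blast
  show "f x = f y"
  proof (rule ccontr)
    assume "f x \<noteq> f y"
    then have less: "f x < f y"
      using collapsing_mono[OF f xy] by simp
    obtain n where n: "f ` letters w = {1..n}"
      using r reduced_iff letters_map[of f w] by metis
    have "\<exists>z\<in>A. f z = Suc (f x)"
    proof (cases "f y = Suc (f x)")
      case True
      then show ?thesis using A xy by auto
    next
      case False
      have "f y \<in> {1..n}" using n xy by blast
      then have "Suc (f x) \<in> f ` letters w"
        using n less by auto
      then obtain z where z: "z \<in> letters w" "f z = Suc (f x)" by (metis imageE)
      have "z \<le> y"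
        using collapsing_mono[OF f, of y z] z xy less False by force
      moreover have "x \<le> z"
        using collapsing_mono[OF f, of z x] z xy by force
      ultimately show ?thesis
        using z A by auto
    qed
    moreover have "x \<in> A" using A xy by auto
    ultimately have "f x \<in> f ` A" "Suc (f x) \<in> f ` A" by force+
    moreover have "f ` A \<in> set (map ((`) f) w)" using A by auto
    ultimately show False
      using r reduced_iff by blast
  qed
qed

text \<open>The values of \<open>f\<close> fill an initial interval and increase weakly, so
  \<open>f x\<close> counts the distinct values taken up to \<open>x\<close>. Thus the kernel of
  \<open>f\<close> determines \<open>f\<close> on the letters.\<close>

lemma collapsing_card:
  assumes f: "collapsing f w" and r: "reduced (map ((`) f) w)" and x: "x \<in> letters w"
  shows "f x = card (f ` {y\<in>letters w. y \<le> x})"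
proof -
  obtain n where n: "f ` letters w = {1..n}"
    using r reduced_iff letters_map[of f w] by metis
  have "f ` {y\<in>letters w. y \<le> x} = {1..f x}"
  proof (intro equalityI subsetI)
    fix k assume "k \<in> f ` {y\<in>letters w. y \<le> x}"
    then show "k \<in> {1..f x}"
      using collapsing_mono[OF f] collapsing_pos[OF f] x by (force simp: Suc_le_eq)
  next
    fix k assume k: "k \<in> {1..f x}"
    have "f x \<in> {1..n}" using n x by blast
    then have "k \<in> f ` letters w"
      using k n by auto
    then obtain y where y: "y \<in> letters w" "k = f y" by blast
    show "k \<in> f ` {y\<in>letters w. y \<le> x}"
    proof (cases "y \<le> x")
      case False
      then have "k = f x"
        using collapsing_mono[OF f x y(1)] k y by auto
      then show ?thesis using x by auto
    qed (use y in auto)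
  qed
  then show ?thesis by simp
qed

text \<open>By \<open>collapsing_kernel_iff\<close> both maps identify the same letters, and by
  \<open>collapsing_card\<close> their values are then recovered by counting.\<close>

lemma collapsing_unique:
  assumes f: "collapsing f w" "reduced (map ((`) f) w)"
    and g: "collapsing g w" "reduced (map ((`) g) w)"
    and w: "scomp w" "x \<in> letters w"
  shows "f x = g x"
proof -
  let ?S = "{y\<in>letters w. y \<le> x}"
  have iff: "f a = f b \<longleftrightarrow> g a = g b" if "a \<in> letters w" "b \<in> letters w" for a b
  proof (cases "a \<le> b")
    case True
    then show ?thesis
      using collapsing_kernel_iff[OF f that] collapsing_kernel_iff[OF g that] by simp
  next
    case False
    then show ?thesis
      using collapsing_kernel_iff[OF f that(2,1)] collapsing_kernel_iff[OF g that(2,1)]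
      by (simp add: eq_commute)
  qed
  have fin: "finite ?S"
    using scomp_finite[OF w(1)] by simp
  have "f a = f b \<longleftrightarrow> g a = g b" if "a \<in> ?S" "b \<in> ?S" for a b
    using that by (intro iff) blast+
  then have "card (f ` ?S) = card (g ` ?S)"
    using card_image_kernel_le[OF fin, of f g] card_image_kernel_le[OF fin, of g f]
    by (metis (no_types, lifting) order_antisym)
  then show ?thesis
    using collapsing_card[OF f w(2)] collapsing_card[OF g w(2)] by simp
qed

text \<open>Every multi-permutation reachable by rewriting is a collapse of \<open>w\<close> and so
  coincides with \<open>t\<close> by uniqueness; one is reachable by termination. This justifies the
  definite description in \<open>st\<close>: exhibiting any collapse onto a multi-permutation
  computes the standardization.\<close>

lemma st_eqI:
  assumes "scomp w" "collapsing f w" "blocks t = map ((`) f) w"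
  shows "st w = t"
proof -
  have uniq: "v = t" if v: "st_step\<^sup>*\<^sup>* w (blocks v)" for v
  proof -
    obtain g where g: "collapsing g w" "blocks v = map ((`) g) w"
      using st_steps_collapsing[OF v assms(1)] by blast
    have "f x = g x" if "x \<in> letters w" for x
      using collapsing_unique[OF assms(2) _ g(1) _ assms(1) that] reduced_blocks[of t] reduced_blocks[of v]
      unfolding g(2) assms(3) by blast
    then have "blocks v = blocks t"
      unfolding g(2) assms(3) by (rule map_image_cong[symmetric])
    then show ?thesis
      by (simp add: blocks_inject)
  qed
  obtain v where "st_step\<^sup>*\<^sup>* w (blocks v)"
    using st_steps_exist[OF assms(1)] by blast
  with uniq have "st_step\<^sup>*\<^sup>* w (blocks t)" by blast
  with uniq show ?thesis
    unfolding st_def by blast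
qed

lemma st_collapsing:
  assumes "scomp w"
  obtains f where "collapsing f w" "blocks (st w) = map ((`) f) w"
  by (metis assms st_eqI st_steps_exist st_steps_collapsing)

lemma st_blocks [simp]: "st (blocks t) = t"
  by (rule st_eqI[OF scomp_blocks collapsing_id[OF scomp_blocks]]) (simp add: map_idI[of _ "(`) (\<lambda>x. x)"])

text \<open>Following \<open>f\<close> by the collapse that standardizes the image yields a collapse
  of \<open>w\<close> onto the same multi-permutation.\<close>

lemma st_collapse:
  assumes "scomp w" "collapsing f w"
  shows "st (map ((`) f) w) = st w"
proof -
  obtain g where "collapsing g (map ((`) f) w)" "blocks (st (map ((`) f) w)) = map ((`) g) (map ((`) f) w)"
    using st_collapsing[OF scomp_collapse[OF assms]] by blast
  then show ?thesis
    using st_eqI[OF assms(1) collapsing_comp[OF assms(2)]] map_image_comp by metis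
qed

section \<open>Standardizing the restriction to an interval of letters\<close>

lemma collapsing_shift: "letters w \<subseteq> {c<..} \<Longrightarrow> collapsing (\<lambda>x. x - c) w"
  unfolding collapsing_def mono_on_def
proof (intro conjI ballI allI impI)
  fix A x y assume *: "letters w \<subseteq> {c<..}" "A \<in> set w" "x \<in> A" "y \<in> letters w" "x - c = y - c"
  then have "c < x" "c < y" by blast+
  with *(5) have "x = y" by linarith
  with *(3) show "y \<in> A" by simp
qed auto

lemma shift_interval: "(\<lambda>x. x - c) ` {c + 1..c + n} = {1..n::nat}"
proof (intro equalityI subsetI)
  fix k assume "k \<in> {1..n}"
  then show "k \<in> (\<lambda>x. x - c) ` {c + 1..c + n}"
    by (intro image_eqI[of _ _ "k + c"]) auto
qed auto

text \<open>Restricting to an interval leaves no gaps, and a shift preserves adjacency in both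
  directions, so no consecutive letters can appear in a common block.\<close>

lemma reduced_interval:
  assumes t: "reduced t" and I: "{c + 1..c + n} \<subseteq> letters t"
  shows "reduced (map ((`) (\<lambda>x. x - c)) (restr t {c + 1..c + n}))" (is "reduced ?s")
  unfolding reduced_iff
proof (intro conjI ballI allI notI exI)
  let ?r = "restr t {c + 1..c + n}"
  have l: "letters ?r = {c + 1..c + n}"
    using I by auto
  show "scomp ?s"
    using t reduced_iff by (intro scomp_collapse scomp_restr collapsing_shift) (auto simp: l)
  show "letters ?s = {1..n}"
    unfolding letters_map l shift_interval ..
  fix B i assume B: "B \<in> set ?s" "i \<in> B \<and> Suc i \<in> B"
  then obtain A where A: "A \<in> set t" "B = (\<lambda>x. x - c) ` (A \<inter> {c + 1..c + n})"
    by (auto simp: restr_def)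
  then obtain x y where xy: "x \<in> A" "c < x" "i = x - c" "y \<in> A" "c < y" "Suc i = y - c"
    using B(2) by auto
  then have "y = Suc x" by simp
  with A(1) xy t reduced_iff show False by blast
qed

text \<open>Standardization is here a mere shift, which makes it possible to undo it when a term of
  the product is lifted to a quasi-shuffle.\<close>

lemma st_interval:
  assumes t: "reduced t" and I: "{c + 1..c + n} \<subseteq> letters t"
  shows "blocks (st (restr t {c + 1..c + n})) = map ((`) (\<lambda>x. x - c)) (restr t {c + 1..c + n})"
proof -
  obtain v where v: "blocks v = map ((`) (\<lambda>x. x - c)) (restr t {c + 1..c + n})"
    using reduced_obtain[OF reduced_interval[OF assms]] by blast
  moreover have "st (restr t {c + 1..c + n}) = v"
    using t[unfolded reduced_iff] by (intro st_eqI[OF _ _ v] scomp_restr collapsing_shift) auto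
  ultimately show ?thesis by simp
qed


section \<open>Preimages of set compositions\<close>

text \<open>The inverse construction to collapsing: once the letters \<open>S\<close> and the map
  \<open>f\<close> are known, a composition is recovered from its collapse \<open>t\<close> by
  taking preimages of blocks.\<close>

definition pull :: "(nat \<Rightarrow> nat) \<Rightarrow> nat set \<Rightarrow> nat set list \<Rightarrow> nat set list" where
  "pull f S t = map (\<lambda>T. {x\<in>S. f x \<in> T}) t"

text \<open>Each block is the full preimage of its image among the letters, because it is a union of
  fibres.\<close>

lemma pull_collapse:
  assumes "collapsing f w"
  shows "pull f (letters w) (map ((`) f) w) = w"
proof -
  have "{x\<in>letters w. f x \<in> f ` A} = A" if A: "A \<in> set w" for A
    using collapsing_kernel[OF assms A] A by (auto simp: image_iff) metis
  then show ?thesis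
    by (simp add: pull_def map_idI)
qed

lemma collapse_pull:
  assumes "letters t \<subseteq> f ` S"
  shows "map ((`) f) (pull f S t) = t"
proof -
  have "f ` {x\<in>S. f x \<in> T} = T" if T: "T \<in> set t" for T
  proof -
    have "T \<subseteq> f ` S" using assms T by blast
    then show ?thesis by blast
  qed
  then show ?thesis
    by (simp add: pull_def map_idI)
qed

lemma letters_pull: "letters (pull f S t) = {x\<in>S. f x \<in> letters t}"
  by (auto simp: pull_def)

lemma pull_cong: "(\<And>x. x \<in> S \<Longrightarrow> f x = g x) \<Longrightarrow> pull f S t = pull g S t"
  by (auto simp: pull_def)

lemma scomp_pull:
  assumes "scomp t" "letters t \<subseteq> f ` S" "finite S" "0 \<notin> S"
  shows "scomp (pull f S t)"
  using assms(1,2)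
proof (induction t)
  case (Cons T t)
  then have "T \<subseteq> f ` S" "T \<noteq> {}" by auto
  then have "{x\<in>S. f x \<in> T} \<noteq> {}" by blast
  moreover have "{x\<in>S. f x \<in> T} \<inter> letters (pull f S t) = {}"
    using Cons.prems by (auto simp: letters_pull)
  moreover have "scomp (pull f S t)" using Cons by simp
  ultimately show ?case
    using assms(3,4) by (simp add: pull_def)
qed (simp add: pull_def)

lemma collapsing_pull:
  assumes "scomp t" "mono_on S f"
  shows "collapsing f (pull f S t)"
  unfolding collapsing_def
proof (intro conjI ballI impI)
  show "mono_on (letters (pull f S t)) f"
    using assms(2) by (rule mono_on_subset) (auto simp: letters_pull)
  fix x assume "x \<in> letters (pull f S t)"
  then show "0 < f x"
    using scomp_zero[OF assms(1)] by (cases "f x = 0") (auto simp: letters_pull)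
qed (auto simp: pull_def)

lemma restr_pull:
  assumes "A \<subseteq> S"
  shows "restr (pull f S t) A = pull f A (restr t (f ` A))"
proof (induction t)
  case (Cons T t)
  have "{x\<in>S. f x \<in> T} \<inter> A = {x\<in>A. f x \<in> T \<inter> f ` A}"
    using assms by auto
  moreover have "{x\<in>A. f x \<in> T \<inter> f ` A} = {} \<longleftrightarrow> T \<inter> f ` A = {}"
    by blast
  ultimately show ?case
    using Cons by (simp add: pull_def)
qed (simp add: pull_def)


section \<open>Quasi-shuffles\<close>

text \<open>No order between the letters of \<open>w\<close> and \<open>u\<close> is built in, so
  the notion is symmetric. The order enters only when quasi-shuffles are compared with the product.
  A block of \<open>v\<close> may combine a block of \<open>w\<close> with one of
  \<open>u\<close>.\<close>

definition qshuffle :: "nat set list \<Rightarrow> nat set list \<Rightarrow> nat set list set" where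
  "qshuffle w u = {v. scomp v \<and> letters v = letters w \<union> letters u \<and>
    restr v (letters w) = w \<and> restr v (letters u) = u}"

lemma finite_qshuffle:
  assumes "scomp w" "scomp u"
  shows "finite (qshuffle w u)"
proof (rule finite_subset)
  show "qshuffle w u \<subseteq> {v. scomp v \<and> letters v = letters w \<union> letters u}"
    by (auto simp: qshuffle_def)
  show "finite {v. scomp v \<and> letters v = letters w \<union> letters u}"
    by (intro finite_scomp) (simp add: assms scomp_finite)
qed

section \<open>The position of the two factors inside a standardized quasi-shuffle\<close>

lemma upclosed_interval:
  fixes S :: "nat set"
  assumes "S \<subseteq> {1..N}" "\<And>i x. x \<in> S \<Longrightarrow> x \<le> i \<Longrightarrow> i \<le> N \<Longrightarrow> i \<in> S"
  shows "\<exists>c\<le>N. S = {c + 1..N}"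
proof -
  have "\<exists>c. {1..N} - S = {1..c}"
  proof (rule downclosed_interval)
    fix i x assume "0 < i" "i \<le> x" "x \<in> {1..N} - S"
    then show "i \<in> {1..N} - S"
      using assms(2)[of i x] by auto
  qed auto
  then obtain c where c: "{1..N} - S = {1..c}" by blast
  have "c \<le> N"
  proof (cases c)
    case (Suc k)
    then have "c \<in> {1..c}" by simp
    then have "c \<in> {1..N}" using c by blast
    then show ?thesis by simp
  qed simp
  moreover have "S = {1..N} - {1..c}"
    using c assms(1) by blast
  then have "S = {c + 1..N}" by auto
  ultimately show ?thesis by blast
qed

lemma deg_st:
  assumes "collapsing f w" "blocks (st w) = map ((`) f) w"
  shows "f ` letters w = {1..deg (st w)}"
  using assms(2) letters_blocks letters_map by metis

text \<open>Since the letters of \<open>w\<close> precede those of \<open>u\<close>, the map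
  \<open>f\<close> sends them onto an initial and a final interval of
  \<open>{1..deg (st v)}\<close>. Restrictions to intervals stay reduced up to a shift, so
  uniqueness forces \<open>f\<close> to be \<open>g\<close> on the first and a translate of
  \<open>h\<close> on the second. The intervals cover everything and overlap in at most one value,
  whence the two possible offsets \<open>c\<close>. The first conclusion shows that the natural
  subtraction defining \<open>c\<close> does not truncate.\<close>

lemma qshuffle_collapse:
  assumes w: "scomp w" and u: "scomp u"
    and less: "\<And>a b. a \<in> letters w \<Longrightarrow> b \<in> letters u \<Longrightarrow> a < b"
    and v: "v \<in> qshuffle w u"
    and f: "collapsing f v" "blocks (st v) = map ((`) f) v"
    and g: "collapsing g w" "blocks (st w) = map ((`) g) w"
    and h: "collapsing h u" "blocks (st u) = map ((`) h) u"
  defines "c \<equiv> deg (st v) - deg (st u)"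
  shows "deg (st v) = c + deg (st u)" "c = deg (st w) \<or> c + 1 = deg (st w) \<and> letters u \<noteq> {}"
    "\<And>x. x \<in> letters w \<Longrightarrow> f x = g x" "\<And>x. x \<in> letters u \<Longrightarrow> f x = h x + c"
proof -
  define N where "N = deg (st v)"
  have sv: "scomp v" "letters v = letters w \<union> letters u" "restr v (letters w) = w" "restr v (letters u) = u"
    using v by (auto simp: qshuffle_def)
  have fN: "f ` letters w \<union> f ` letters u = {1..N}"
    using deg_st[OF f] unfolding sv(2) image_Un N_def .
  have le: "f a \<le> f b" if "a \<in> letters w" "b \<in> letters u" for a b
    using that less[OF that] sv(2) by (intro collapsing_mono[OF f(1)]) (simp_all only: Un_iff less_imp_le simp_thms)
  have red: "reduced (map ((`) f) v)"
    using reduced_blocks[of "st v"] f(2) by simp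
  have lfv: "letters (map ((`) f) v) = {1..N}"
    using deg_st[OF f] unfolding letters_map N_def .
  have sub: "letters w \<subseteq> letters v" "letters u \<subseteq> letters v"
    using sv(2) by simp_all
  have fw: "collapsing f w" and fu: "collapsing f u"
    using collapsing_restr[OF f(1)] sv(3,4) by metis+
  have rw: "restr (map ((`) f) v) (f ` letters w) = map ((`) f) w"
    using restr_collapse[OF f(1) sub(1)] unfolding sv(3) .
  have ru: "restr (map ((`) f) v) (f ` letters u) = map ((`) f) u"
    using restr_collapse[OF f(1) sub(2)] unfolding sv(4) .
  have "\<exists>k. f ` letters w = {1..k}"
  proof (rule downclosed_interval)
    fix i x assume i: "0 < i" "i \<le> x" "x \<in> f ` letters w"
    then have "x \<in> {1..N}" using fN by blast
    then have "i \<in> {1..N}" using i by simp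
    \<comment> \<open>A value of \<open>u\<close> is at least every value of \<open>w\<close>;
      together with \<open>i \<le> x\<close> this forces \<open>i = x\<close>, a value of
      \<open>w\<close>.\<close>
    moreover have "i \<in> f ` letters w" if iu: "i \<in> f ` letters u"
    proof -
      obtain a where "x = f a" "a \<in> letters w" using i(3) by (rule imageE)
      moreover obtain b where "i = f b" "b \<in> letters u" using iu by (rule imageE)
      ultimately have "i = x" using le i(2) order_antisym by metis
      with i show ?thesis by simp
    qed
    ultimately show "i \<in> f ` letters w" using fN by blast
  next
    show "0 \<notin> f ` letters w" using collapsing_pos[OF fw] by force
  qed (simp add: scomp_finite[OF w])
  then obtain k where k: "f ` letters w = {1..k}" by blast
  have kN: "{1..k} \<subseteq> {1..N}" unfolding fN[symmetric] k by (rule Un_upper1)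
  \<comment> \<open>The initial interval is the instance of \<open>reduced_interval\<close> with
    shift 0.\<close>
  have "reduced (map ((`) (\<lambda>x. x - 0)) (restr (map ((`) f) v) {0 + 1..0 + k}))"
    using kN lfv by (intro reduced_interval[OF red]) simp
  then have "reduced (map ((`) f) w)"
    using rw k by (simp add: map_idI)
  then show fg: "f x = g x" if "x \<in> letters w" for x
    using reduced_blocks[of "st w"] unfolding g(2) by (intro collapsing_unique[OF fw _ g(1) _ w that])
  have km: "{1..k} = {1..deg (st w)}"
    using deg_st[OF g] k fg by (metis image_cong)
  have "\<exists>d\<le>N. f ` letters u = {d + 1..N}"
  proof (rule upclosed_interval)
    show "f ` letters u \<subseteq> {1..N}" using fN by blast
    fix i x assume i: "x \<in> f ` letters u" "x \<le> i" "i \<le> N"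
    then have "x \<in> {1..N}" using fN by blast
    then have "i \<in> {1..N}" using i by simp
    moreover have "i \<in> f ` letters u" if iw: "i \<in> f ` letters w"
    proof -
      obtain a where "i = f a" "a \<in> letters w" using iw by (rule imageE)
      moreover obtain b where "x = f b" "b \<in> letters u" using i(1) by (rule imageE)
      ultimately have "i = x" using le i(2) order_antisym by metis
      with i show ?thesis by simp
    qed
    ultimately show "i \<in> f ` letters u" using fN by blast
  qed
  then obtain d where d: "d \<le> N" "f ` letters u = {d + 1..d + (N - d)}" by auto
  have shift: "collapsing (\<lambda>x. x - d) (map ((`) f) u)"
    by (rule collapsing_shift) (unfold letters_map d(2), auto)
  have "reduced (map ((`) (\<lambda>x. x - d)) (restr (map ((`) f) v) {d + 1..d + (N - d)}))"
    using d(1) lfv by (intro reduced_interval[OF red]) auto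
  then have red': "reduced (map ((`) ((\<lambda>x. x - d) \<circ> f)) u)"
    using ru d(2) map_image_comp by metis
  have fh: "f x - d = h x" if "x \<in> letters u" for x
    using collapsing_unique[OF collapsing_comp[OF fu shift] red' h(1) _ u that]
      reduced_blocks[of "st u"] h(2) by simp
  have "{1..deg (st u)} = (\<lambda>x. f x - d) ` letters u"
    using deg_st[OF h] fh by (metis image_cong)
  also have "\<dots> = (\<lambda>x. x - d) ` f ` letters u"
    by (simp add: image_image)
  also have "\<dots> = {1..N - d}"
    unfolding d(2) by (rule shift_interval)
  finally have "deg (st u) = N - d"
    by (metis card_atLeastAtMost diff_Suc_1' diff_Suc_1)
  then have c: "c = d"
    using d(1) unfolding c_def N_def by simp
  show "deg (st v) = c + deg (st u)"
    using \<open>deg (st u) = N - d\<close> d(1) c N_def by simp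
  have "k = deg (st w)"
    using km by (metis card_atLeastAtMost diff_Suc_1)
  show "f x = h x + c" if "x \<in> letters u" for x
  proof -
    have "f x \<in> {d + 1..d + (N - d)}" using d(2) that by blast
    then have "d \<le> f x" by simp
    then show ?thesis using fh[OF that] c by linarith
  qed
  have un: "{1..k} \<union> {d + 1..N} = {1..N}"
    using fN k d by simp
  \<comment> \<open>Otherwise \<open>k + 1\<close> would be missed by both intervals.\<close>
  have "d \<le> k"
  proof (rule ccontr)
    assume "\<not> d \<le> k"
    then have "k + 1 \<in> {1..N}" "k + 1 \<notin> {1..k} \<union> {d + 1..N}"
      using d(1) by auto
    with un show False by simp
  qed
  \<comment> \<open>In an overlap, \<open>k\<close> is a value on \<open>w\<close> and
    \<open>d + 1\<close> a value on \<open>u\<close>, so monotonicity gives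
    \<open>k \<le> d + 1\<close>: at most one value is shared.\<close>
  moreover have "k \<le> d + 1 \<and> letters u \<noteq> {}" if "d < k"
  proof
    have "d + 1 \<in> {1..N}" using that kN by auto
    then have *: "d + 1 \<in> f ` letters u" using d(1,2) by simp
    then show "letters u \<noteq> {}" by blast
    have "k \<in> f ` letters w" using that k by simp
    then show "k \<le> d + 1"
      using le * by (metis imageE)
  qed
  ultimately show "c = deg (st w) \<or> c + 1 = deg (st w) \<and> letters u \<noteq> {}"
    using c \<open>k = deg (st w)\<close> by (cases "d = k") auto
qed

text \<open>Unites the two kinds of terms: \<open>c\<close> is the offset at which the letters of
  \<open>u\<close> begin, and writing \<open>c + 1 = deg w\<close> avoids truncated subtraction.
  Terms of the second kind exist only when both degrees are positive: for \<open>deg u = 0\<close>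
  the term would have too few letters to restrict to \<open>w\<close>, and for
  \<open>deg w = 0\<close> the term would be its own restriction and hence equal to
  \<open>u\<close>, contradicting its degree.\<close>

lemma prod_terms_iff:
  "t \<in> prod_terms w u \<longleftrightarrow>
    (\<exists>c. deg t = c + deg u \<and> (c = deg w \<or> c + 1 = deg w \<and> deg u \<noteq> 0) \<and>
      restr (blocks t) {1..deg w} = blocks w \<and> st (restr (blocks t) {c + 1..c + deg u}) = u)"
  (is "?L \<longleftrightarrow> ?R")
proof
  assume L: ?L
  show ?R
  proof (cases "deg t = deg w + deg u")
    case True
    then show ?thesis
      using L by (intro exI[of _ "deg w"]) (auto simp: prod_terms_def Let_def)
  next
    case False
    then have t: "deg t + 1 = deg w + deg u" "restr (blocks t) {1..deg w} = blocks w"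
      "st (restr (blocks t) {deg w..deg w + deg u - 1}) = u"
      using L by (auto simp: prod_terms_def Let_def)
    have "deg u \<noteq> 0"
    proof
      assume "deg u = 0"
      then have "letters (blocks t) \<subset> letters (blocks w)"
        using t(1) by (auto simp: letters_blocks)
      then show False
        using t(2) letters_restr[of "blocks t" "{1..deg w}"] by auto
    qed
    moreover have "deg w \<noteq> 0"
    proof
      assume "deg w = 0"
      then have "restr (blocks t) {deg w..deg w + deg u - 1} = blocks t"
        using t(1) by (intro restr_superset) (auto simp: letters_blocks)
      then show False using t \<open>deg w = 0\<close> by simp
    qed
    ultimately show ?thesis
      using t by (intro exI[of _ "deg w - 1"]) auto
  qed
next
  assume ?R
  then obtain c where c: "deg t = c + deg u" "c = deg w \<or> c + 1 = deg w \<and> deg u \<noteq> 0"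
    "restr (blocks t) {1..deg w} = blocks w" "st (restr (blocks t) {c + 1..c + deg u}) = u"
    by blast
  show ?L
  proof (cases "c = deg w")
    case True
    with c show ?thesis by (simp add: prod_terms_def Let_def)
  next
    case False
    with c(2) have "deg w = c + 1" by simp
    with c show ?thesis by (simp add: prod_terms_def Let_def)
  qed
qed

text \<open>The collapse of \<open>v\<close> commutes with restriction to the letters of
  \<open>w\<close> and of \<open>u\<close>, and \<open>qshuffle_collapse\<close> identifies the
  images of these sets with the intervals that occur in the product.\<close>

lemma st_qshuffle_mem:
  assumes w: "scomp w" and u: "scomp u"
    and less: "\<And>a b. a \<in> letters w \<Longrightarrow> b \<in> letters u \<Longrightarrow> a < b"
    and v: "v \<in> qshuffle w u"
  shows "st v \<in> prod_terms (st w) (st u)"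
proof -
  have sv: "scomp v" "letters v = letters w \<union> letters u" "restr v (letters w) = w" "restr v (letters u) = u"
    using v by (auto simp: qshuffle_def)
  obtain f where f: "collapsing f v" "blocks (st v) = map ((`) f) v"
    using st_collapsing[OF sv(1)] .
  obtain g where g: "collapsing g w" "blocks (st w) = map ((`) g) w"
    using st_collapsing[OF w] .
  obtain h where h: "collapsing h u" "blocks (st u) = map ((`) h) u"
    using st_collapsing[OF u] .
  define c where "c = deg (st v) - deg (st u)"
  note key = qshuffle_collapse[OF w u less v f g h, folded c_def]
  have sub: "letters w \<subseteq> letters v" "letters u \<subseteq> letters v"
    using sv(2) by simp_all
  have "f ` letters w = g ` letters w"
    by (intro image_cong refl key(3))
  then have "f ` letters w = {1..deg (st w)}"
    using deg_st[OF g] by simp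
  then have "restr (blocks (st v)) {1..deg (st w)} = map ((`) f) w"
    using restr_collapse[OF f(1) sub(1)] f(2) sv(3) by simp
  also have "\<dots> = blocks (st w)"
    unfolding g(2) by (rule map_image_cong) (simp only: key(3))
  finally have 1: "restr (blocks (st v)) {1..deg (st w)} = blocks (st w)" .
  have "f ` letters u = (\<lambda>x. x + c) ` h ` letters u"
    unfolding image_image by (intro image_cong refl key(4))
  then have "f ` letters u = {c + 1..c + deg (st u)}"
    using deg_st[OF h] by (simp add: add.commute)
  then have "restr (blocks (st v)) {c + 1..c + deg (st u)} = map ((`) f) u"
    using restr_collapse[OF f(1) sub(2)] f(2) sv(4) by simp
  then have 2: "st (restr (blocks (st v)) {c + 1..c + deg (st u)}) = st u"
    using st_collapse[OF u] collapsing_restr[OF f(1)] sv(4) by metis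
  have "deg (st u) \<noteq> 0" if "letters u \<noteq> {}"
    using deg_st[OF h] that by auto
  with 1 2 key(1,2) show ?thesis
    unfolding prod_terms_iff by blast
qed

text \<open>By \<open>qshuffle_collapse\<close> the standardizing map of \<open>v\<close> depends
  only on \<open>w\<close>, \<open>u\<close> and \<open>st v\<close>; pulling \<open>st v\<close>
  back along it recovers \<open>v\<close>.\<close>

lemma st_qshuffle_inj:
  assumes w: "scomp w" and u: "scomp u"
    and less: "\<And>a b. a \<in> letters w \<Longrightarrow> b \<in> letters u \<Longrightarrow> a < b"
  shows "inj_on st (qshuffle w u)"
proof (rule inj_onI)
  fix v v' assume v: "v \<in> qshuffle w u" and v': "v' \<in> qshuffle w u" and eq: "st v = st v'"
  obtain g where g: "collapsing g w" "blocks (st w) = map ((`) g) w"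
    using st_collapsing[OF w] .
  obtain h where h: "collapsing h u" "blocks (st u) = map ((`) h) u"
    using st_collapsing[OF u] .
  have "scomp v" "scomp v'" and l: "letters v = letters w \<union> letters u" "letters v' = letters w \<union> letters u"
    using v v' by (auto simp: qshuffle_def)
  then obtain f f' where f: "collapsing f v" "blocks (st v) = map ((`) f) v"
    and f': "collapsing f' v'" "blocks (st v') = map ((`) f') v'"
    using st_collapsing by metis
  note key = qshuffle_collapse[OF w u less v f g h]
  note key' = qshuffle_collapse[OF w u less v' f' g h, folded eq]
  have "f x = f' x" if "x \<in> letters w \<union> letters u" for x
    using that key(3,4) key'(3,4) by (metis UnE)
  then have "pull f (letters v) (blocks (st v)) = pull f' (letters v') (blocks (st v'))"
    unfolding eq l by (rule pull_cong)
  then show "v = v'"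
    using pull_collapse[OF f(1)] pull_collapse[OF f'(1)] f(2) f'(2) by simp
qed

text \<open>The required quasi-shuffle is the preimage of \<open>t\<close> under the only possible
  standardizing map, glued from those of \<open>w\<close> and \<open>u\<close> with offset
  \<open>c\<close>.\<close>

lemma prod_terms_subset_st_qshuffle:
  assumes w: "scomp w" and u: "scomp u"
    and less: "\<And>a b. a \<in> letters w \<Longrightarrow> b \<in> letters u \<Longrightarrow> a < b"
    and t: "t \<in> prod_terms (st w) (st u)"
  shows "t \<in> st ` qshuffle w u"
proof -
  obtain g where g: "collapsing g w" "blocks (st w) = map ((`) g) w"
    using st_collapsing[OF w] .
  obtain h where h: "collapsing h u" "blocks (st u) = map ((`) h) u"
    using st_collapsing[OF u] .
  let ?m = "deg (st w)" and ?n = "deg (st u)" and ?S = "letters w \<union> letters u"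
  obtain c where c: "deg t = c + ?n" "c = ?m \<or> c + 1 = ?m \<and> ?n \<noteq> 0"
    and tw: "restr (blocks t) {1..?m} = blocks (st w)"
    and tu: "st (restr (blocks t) {c + 1..c + ?n}) = st u"
    using t unfolding prod_terms_iff by blast
  define f where "f x = (if x \<in> letters w then g x else h x + c)" for x
  have fw: "f x = g x" if "x \<in> letters w" for x
    using that by (simp add: f_def)
  have fu: "f x = h x + c" if "x \<in> letters u" for x
    using that less[of x x] unfolding f_def by (meson less_irrefl)
  have iw: "f ` letters w = {1..?m}"
    using deg_st[OF g] fw by (metis image_cong)
  have "f ` letters u = (\<lambda>x. x + c) ` h ` letters u"
    unfolding image_image by (intro image_cong refl fu)
  then have iu: "f ` letters u = {c + 1..c + ?n}"
    using deg_st[OF h] by (simp add: add.commute)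
  have iS: "f ` ?S = letters (blocks t)"
    unfolding image_Un iw iu letters_blocks c(1) using c(2) by auto
  have "f x \<le> f y" if xy: "x \<in> ?S" "y \<in> ?S" "x \<le> y" for x y
  proof -
    consider "x \<in> letters w" "y \<in> letters w" | "x \<in> letters u" "y \<in> letters u"
      | "x \<in> letters w" "y \<in> letters u" | "x \<in> letters u" "y \<in> letters w"
      using xy(1,2) by (elim UnE) (erule (1) that)+
    then show ?thesis
    proof cases
      case 1
      then show ?thesis using fw collapsing_mono[OF g(1)] xy(3) by metis
    next
      case 2
      then show ?thesis using fu collapsing_mono[OF h(1)] xy(3) by (metis add_le_mono1)
    next
      case 3
      \<comment> \<open>Here \<open>?m \<le> c + 1\<close>, so the gluing is monotone even when the
        two intervals share a value.\<close>
      then have "f x \<in> {1..?m}" "f y \<in> {c + 1..c + ?n}"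
        using iw iu by blast+
      then show ?thesis using c(2) by auto
    next
      case 4
      then show ?thesis using less[of y x] xy(3) by simp
    qed
  qed
  then have mono: "mono_on ?S f"
    by (rule mono_onI)
  define v where "v = pull f ?S (blocks t)"
  have fin: "finite ?S" "0 \<notin> ?S"
    using scomp_finite scomp_zero w u by auto
  have sv: "scomp v"
    unfolding v_def using scomp_pull[OF scomp_blocks _ fin] iS by simp
  have lv: "letters v = ?S"
    unfolding v_def letters_pull using iS by blast
  have "restr v (letters w) = pull f (letters w) (map ((`) g) w)"
    unfolding v_def using restr_pull[of "letters w" ?S f "blocks t"] iw tw g(2) by simp
  also have "\<dots> = pull g (letters w) (map ((`) g) w)"
    by (rule pull_cong) (rule fw)
  also have "\<dots> = w"
    by (rule pull_collapse[OF g(1)])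
  finally have rw: "restr v (letters w) = w" .
  \<comment> \<open>The assumption on \<open>t\<close> only compares standardizations. On an
    interval these are shifts, so shifting back identifies the restriction itself with the image of
    \<open>u\<close> under \<open>f\<close>.\<close>
  have "{c + 1..c + ?n} \<subseteq> letters (blocks t)"
    using c(1) by (auto simp: letters_blocks)
  then have hs: "map ((`) (\<lambda>x. x - c)) (restr (blocks t) {c + 1..c + ?n}) = map ((`) h) u"
    using st_interval[OF reduced_blocks, of c ?n t] tu h(2) by simp
  have "map ((`) f) u = map ((`) (\<lambda>x. x + c)) (map ((`) h) u)"
    unfolding map_image_comp by (rule map_image_cong) (simp only: fu o_apply)
  also have "\<dots> = map ((`) ((\<lambda>x. x + c) \<circ> (\<lambda>x. x - c))) (restr (blocks t) {c + 1..c + ?n})"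
    unfolding hs[symmetric] map_image_comp ..
  also have "\<dots> = map ((`) (\<lambda>x. x)) (restr (blocks t) {c + 1..c + ?n})"
    by (rule map_image_cong) auto
  finally have hu: "restr (blocks t) {c + 1..c + ?n} = map ((`) f) u"
    by (simp add: map_idI[of _ "(`) (\<lambda>x. x)"])
  have fcu: "collapsing f u"
    unfolding collapsing_def
  proof (intro conjI ballI impI)
    show "mono_on (letters u) f"
      using mono by (rule mono_on_subset) simp
    show "0 < f x" if "x \<in> letters u" for x
      using fu[OF that] collapsing_pos[OF h(1) that] by simp
    fix A x y assume A: "A \<in> set u" "x \<in> A" "y \<in> letters u" "f x = f y"
    then have "x \<in> letters u" by blast
    then show "y \<in> A"
      using A fu collapsing_kernel[OF h(1) A(1,2,3)] by simp
  qed
  have "restr v (letters u) = pull f (letters u) (map ((`) f) u)"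
    unfolding v_def using restr_pull[of "letters u" ?S f "blocks t"] iu hu by simp
  also have "\<dots> = u"
    by (rule pull_collapse[OF fcu])
  finally have ru: "restr v (letters u) = u" .
  have "st v = t"
  proof (rule st_eqI[OF sv])
    show "collapsing f v"
      unfolding v_def by (rule collapsing_pull[OF scomp_blocks mono])
    show "blocks t = map ((`) f) v"
      unfolding v_def using collapse_pull[of "blocks t" f ?S] iS by simp
  qed
  moreover have "v \<in> qshuffle w u"
    using sv lv rw ru by (simp add: qshuffle_def)
  ultimately show ?thesis by blast
qed

lemma bij_betw_st_qshuffle:
  assumes "scomp w" "scomp u" "\<And>a b. a \<in> letters w \<Longrightarrow> b \<in> letters u \<Longrightarrow> a < b"
  shows "bij_betw st (qshuffle w u) (prod_terms (st w) (st u))"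
  unfolding bij_betw_def
  using st_qshuffle_inj[OF assms] st_qshuffle_mem[OF assms] prod_terms_subset_st_qshuffle[OF assms]
  by (intro conjI equalityI subsetI) (auto 0 0)


section \<open>The bialgebra structure\<close>

lemma MMR_mult_frag_of: "MMR_mult (frag_of w) (frag_of u) = (\<Sum>v\<in>prod_terms w u. frag_of v)"
  by (simp add: MMR_mult_def)

section \<open>Biadditive maps and their values on basis elements\<close>

lemma biadditive_frag_extend: "biadditive (\<lambda>x y. frag_extend (\<lambda>a. frag_extend (f a) y) x)"
  unfolding biadditive_def additive_def
  by (simp add: frag_extend_add frag_extend_fun_add)

lemma biadditive_left: "biadditive f \<Longrightarrow> additive (\<lambda>x. f x y)"
  and biadditive_right: "biadditive f \<Longrightarrow> additive (f x)"
  by (simp_all add: biadditive_def)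

lemma additive_o: "additive f \<Longrightarrow> additive g \<Longrightarrow> additive (\<lambda>x. f (g x))"
  by (simp add: additive_def)

lemma biadditive_MMR_mult: "biadditive MMR_mult"
  using biadditive_frag_extend by (simp add: MMR_mult_def[abs_def])

lemma biadditive_tensor_mult: "biadditive (tensor_mult m)"
  using biadditive_frag_extend[of "\<lambda>s (c, d). tensor (m (frag_of (fst s)) (frag_of c)) (m (frag_of (snd s)) (frag_of d))"]
  by (simp add: tensor_mult_def[abs_def] case_prod_unfold)

lemma biadditive_eqI:
  fixes f g :: "('a \<Rightarrow>\<^sub>0 int) \<Rightarrow> ('b \<Rightarrow>\<^sub>0 int) \<Rightarrow> 'c::ab_group_add"
  assumes "biadditive f" "biadditive g" "\<And>a b. f (frag_of a) (frag_of b) = g (frag_of a) (frag_of b)"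
  shows "f x y = g x y"
proof (rule additive_eqI[of "\<lambda>x. f x y" "\<lambda>x. g x y"])
  fix a show "f (frag_of a) y = g (frag_of a) y"
    by (rule additive_eqI) (use assms in \<open>auto simp: biadditive_def\<close>)
qed (use assms in \<open>auto simp: biadditive_def\<close>)

lemma MMR_mult_sum:
  "MMR_mult (sum f A) y = (\<Sum>a\<in>A. MMR_mult (f a) y)"
  "MMR_mult x (sum g B) = (\<Sum>b\<in>B. MMR_mult x (g b))"
  using additive.sum[OF biadditive_left[OF biadditive_MMR_mult]]
    additive.sum[OF biadditive_right[OF biadditive_MMR_mult]] by auto

text \<open>Frees the product from the intervals in its definition: factors may be represented by
  any set compositions with separated letters.\<close>

lemma MMR_mult_st:
  assumes "scomp w" "scomp u" "\<And>a b. a \<in> letters w \<Longrightarrow> b \<in> letters u \<Longrightarrow> a < b"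
  shows "MMR_mult (frag_of (st w)) (frag_of (st u)) = (\<Sum>v\<in>qshuffle w u. frag_of (st v))"
  unfolding MMR_mult_frag_of by (rule sum.reindex_bij_betw[OF bij_betw_st_qshuffle[OF assms], symmetric])

text \<open>Supplies representatives above a given bound, so that the separation required by
  \<open>MMR_mult_st\<close> can always be arranged.\<close>

lemma scomp_shifted:
  obtains w where "scomp w" "letters w \<subseteq> {m<..}" "st w = t"
proof
  let ?w = "map ((`) (\<lambda>x. x + m)) (blocks t)"
  have c: "collapsing (\<lambda>x. x + m) (blocks t)"
    using scomp_zero[OF scomp_blocks, of t] unfolding collapsing_def mono_on_def
    by (auto intro: gr0I)
  show "scomp ?w"
    by (rule scomp_collapse[OF scomp_blocks c])
  show "letters ?w \<subseteq> {m<..}"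
    unfolding letters_map letters_blocks by auto
  show "st ?w = t"
    using st_collapse[OF scomp_blocks c] by simp
qed

section \<open>Associativity of quasi-shuffling and of the product\<close>

definition qshuffle3 :: "nat set list \<Rightarrow> nat set list \<Rightarrow> nat set list \<Rightarrow> nat set list set" where
  "qshuffle3 w u z = {v. scomp v \<and> letters v = letters w \<union> letters u \<union> letters z \<and>
    restr v (letters w) = w \<and> restr v (letters u) = u \<and> restr v (letters z) = z}"

lemma qshuffle_letters: "v \<in> qshuffle w u \<Longrightarrow> letters v = letters w \<union> letters u"
  and qshuffle_scomp: "v \<in> qshuffle w u \<Longrightarrow> scomp v"
  by (simp_all add: qshuffle_def)

lemma qshuffle_restr:
  assumes "scomp t" "letters w \<union> letters u \<subseteq> letters t" "restr t (letters w) = w" "restr t (letters u) = u"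
  shows "restr t (letters w \<union> letters u) \<in> qshuffle w u"
  unfolding qshuffle_def
proof (intro CollectI conjI)
  show "letters (restr t (letters w \<union> letters u)) = letters w \<union> letters u"
    using assms(2) unfolding letters_restr by (rule Int_absorb1)
  have "(letters w \<union> letters u) \<inter> letters w = letters w" "(letters w \<union> letters u) \<inter> letters u = letters u"
    by blast+
  then show "restr (restr t (letters w \<union> letters u)) (letters w) = w"
    "restr (restr t (letters w \<union> letters u)) (letters u) = u"
    by (simp_all only: restr_restr assms(3,4))
qed (rule scomp_restr[OF assms(1)])

lemma restr_restr_subset: "T \<subseteq> S \<Longrightarrow> restr (restr t S) T = restr t T"
  by (simp add: Int_absorb1)

text \<open>The intermediate \<open>v\<close> is determined by \<open>t\<close> as its restriction
  to the letters of \<open>w\<close> and \<open>u\<close>, so the double sum has one summand for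
  each \<open>t\<close>.\<close>

lemma sum_qshuffle_left:
  assumes "scomp w" "scomp u" "scomp z"
  shows "(\<Sum>v\<in>qshuffle w u. \<Sum>t\<in>qshuffle v z. f t) = sum f (qshuffle3 w u z)"
proof -
  have "(\<Sum>v\<in>qshuffle w u. \<Sum>t\<in>qshuffle v z. f t) = (\<Sum>(v, t)\<in>(SIGMA v:qshuffle w u. qshuffle v z). f t)"
    using assms by (intro sum.Sigma ballI finite_qshuffle) (auto dest: qshuffle_scomp)
  also have "\<dots> = sum f (qshuffle3 w u z)"
  proof (rule sum.reindex_bij_witness[where j = snd and i = "\<lambda>t. (restr t (letters w \<union> letters u), t)"])
    fix p assume "p \<in> (SIGMA v:qshuffle w u. qshuffle v z)"
    then obtain v t where p: "p = (v, t)" "v \<in> qshuffle w u" "t \<in> qshuffle v z" by auto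
    then have v: "letters v = letters w \<union> letters u" "restr v (letters w) = w" "restr v (letters u) = u"
      and t: "scomp t" "letters t = letters v \<union> letters z" "restr t (letters v) = v" "restr t (letters z) = z"
      by (auto simp: qshuffle_def)
    show "(restr (snd p) (letters w \<union> letters u), snd p) = p"
      using p(1) t(3) v(1) by simp
    have "restr t (letters w) = w" "restr t (letters u) = u"
      using v t(3) restr_restr_subset[of "letters w" "letters v" t] restr_restr_subset[of "letters u" "letters v" t]
      by simp_all
    then show "snd p \<in> qshuffle3 w u z"
      using p(1) t v by (simp add: qshuffle3_def)
  next
    fix t assume "t \<in> qshuffle3 w u z"
    then have t: "scomp t" "letters t = letters w \<union> letters u \<union> letters z" "restr t (letters w) = w"
      "restr t (letters u) = u" "restr t (letters z) = z"
      by (auto simp: qshuffle3_def)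
    then have v: "restr t (letters w \<union> letters u) \<in> qshuffle w u"
      by (intro qshuffle_restr) simp_all
    then have "t \<in> qshuffle (restr t (letters w \<union> letters u)) z"
      unfolding qshuffle_def[of _ z] using t qshuffle_letters[OF v] by simp
    with v show "(restr t (letters w \<union> letters u), t) \<in> (SIGMA v:qshuffle w u. qshuffle v z)"
      by simp
  qed auto
  finally show ?thesis .
qed

lemma qshuffle_commute: "qshuffle w u = qshuffle u w"
  by (auto simp: qshuffle_def Un_commute)

lemma qshuffle3_commute: "qshuffle3 w u z = qshuffle3 u z w"
  by (auto simp: qshuffle3_def Un_assoc Un_left_commute Un_commute)

lemma sum_qshuffle_right:
  assumes "scomp w" "scomp u" "scomp z"
  shows "(\<Sum>v\<in>qshuffle u z. \<Sum>t\<in>qshuffle w v. f t) = sum f (qshuffle3 w u z)"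
  using sum_qshuffle_left[OF assms(2,3,1), of f]
  by (simp only: qshuffle_commute[of w] qshuffle3_commute[of w])

lemma finite_subset_atMost: "finite S \<Longrightarrow> \<exists>m. S \<subseteq> {..m::nat}"
  by (meson Max_ge atMost_iff subsetI)

lemma MMR_mult_assoc_frag_of:
  "MMR_mult (MMR_mult (frag_of a) (frag_of b)) (frag_of c) =
   MMR_mult (frag_of a) (MMR_mult (frag_of b) (frag_of c))"
proof -
  obtain w where w: "scomp w" "st w = a"
    using scomp_shifted[of 0 a] by blast
  obtain m where m: "letters w \<subseteq> {..m}"
    using finite_subset_atMost scomp_finite[OF w(1)] by blast
  obtain u where u: "scomp u" "letters u \<subseteq> {m<..}" "st u = b"
    using scomp_shifted[of m b] by blast
  obtain n where n: "letters w \<union> letters u \<subseteq> {..n}"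
    using finite_subset_atMost finite_UnI[OF scomp_finite[OF w(1)] scomp_finite[OF u(1)]] by blast
  obtain z where z: "scomp z" "letters z \<subseteq> {n<..}" "st z = c"
    using scomp_shifted[of n c] by blast
  have wu: "x < y" if "x \<in> letters w" "y \<in> letters u" for x y
    using subsetD[OF m that(1)] subsetD[OF u(2) that(2)] by simp
  have wuz: "x < y" if "x \<in> letters w \<union> letters u" "y \<in> letters z" for x y
    using subsetD[OF n that(1)] subsetD[OF z(2) that(2)] by simp
  have "MMR_mult (MMR_mult (frag_of a) (frag_of b)) (frag_of c) =
      (\<Sum>v\<in>qshuffle w u. MMR_mult (frag_of (st v)) (frag_of (st z)))"
    using MMR_mult_st[OF w(1) u(1) wu] w(2) u(3) z(3) by (simp add: MMR_mult_sum)
  also have "\<dots> = (\<Sum>v\<in>qshuffle w u. \<Sum>t\<in>qshuffle v z. frag_of (st t))"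
  proof (rule sum.cong[OF refl])
    fix v assume v: "v \<in> qshuffle w u"
    show "MMR_mult (frag_of (st v)) (frag_of (st z)) = (\<Sum>t\<in>qshuffle v z. frag_of (st t))"
      by (rule MMR_mult_st[OF qshuffle_scomp[OF v] z(1)]) (unfold qshuffle_letters[OF v], rule wuz)
  qed
  also have "\<dots> = (\<Sum>v\<in>qshuffle u z. \<Sum>t\<in>qshuffle w v. frag_of (st t))"
    unfolding sum_qshuffle_left[OF w(1) u(1) z(1)] sum_qshuffle_right[OF w(1) u(1) z(1)] ..
  also have "\<dots> = (\<Sum>v\<in>qshuffle u z. MMR_mult (frag_of (st w)) (frag_of (st v)))"
  proof (rule sum.cong[OF refl])
    fix v assume v: "v \<in> qshuffle u z"
    show "(\<Sum>t\<in>qshuffle w v. frag_of (st t)) = MMR_mult (frag_of (st w)) (frag_of (st v))"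
      by (rule MMR_mult_st[OF w(1) qshuffle_scomp[OF v], symmetric])
        (unfold qshuffle_letters[OF v] Un_iff, metis wu wuz UnI1)
  qed
  also have "\<dots> = MMR_mult (frag_of a) (MMR_mult (frag_of b) (frag_of c))"
    using MMR_mult_st[OF u(1) z(1)] wuz w(2) u(3) z(3) by (simp add: MMR_mult_sum)
  finally show ?thesis .
qed

lemma MMR_mult_assoc: "MMR_mult (MMR_mult x y) z = MMR_mult x (MMR_mult y z)"
proof (rule biadditive_eqI[of "\<lambda>x y. MMR_mult (MMR_mult x y) z" "\<lambda>x y. MMR_mult x (MMR_mult y z)"])
  note add = biadditive_left[OF biadditive_MMR_mult] biadditive_right[OF biadditive_MMR_mult]
  show "biadditive (\<lambda>x y. MMR_mult (MMR_mult x y) z)" "biadditive (\<lambda>x y. MMR_mult x (MMR_mult y z))"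
    unfolding biadditive_def by (intro conjI allI add additive_o[OF _ add(1)] additive_o[OF _ add(2)])+
  show "MMR_mult (MMR_mult (frag_of a) (frag_of b)) z = MMR_mult (frag_of a) (MMR_mult (frag_of b) z)" for a b
    by (rule additive_eqI[of "MMR_mult (MMR_mult (frag_of a) (frag_of b))" "\<lambda>z. MMR_mult (frag_of a) (MMR_mult (frag_of b) z)"])
      (intro add additive_o[OF add(2)] MMR_mult_assoc_frag_of)+
qed

section \<open>The unit\<close>

lemma blocks_empty_mperm [simp]: "blocks empty_mperm = []"
proof -
  have "[] \<in> M_perms 0"
    by (simp add: M_perms_def set_composition_def disjoint_family_on_def)
  then show ?thesis
    unfolding empty_mperm_def by (intro MPerm_inverse) blast
qed

lemma st_Nil: "st [] = empty_mperm"
  using st_blocks[of empty_mperm] by simp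

text \<open>Standardization preserves the number of blocks.\<close>

lemma st_eq_empty_iff: "scomp w \<Longrightarrow> st w = empty_mperm \<longleftrightarrow> w = []"
  by (metis Nil_is_map_conv blocks_empty_mperm st_Nil st_collapsing)

lemma qshuffle_Nil: "scomp w \<Longrightarrow> qshuffle [] w = {w}"
  by (auto simp: qshuffle_def restr_superset) (auto simp: restr_def intro!: filter_False)

lemma MMR_mult_unit_left: "MMR_mult (MMR_unit 1) x = x"
proof (rule additive_eqI[of "MMR_mult (MMR_unit 1)" "\<lambda>x. x"])
  fix a show "MMR_mult (MMR_unit 1) (frag_of a) = frag_of a"
    using MMR_mult_st[of "[]" "blocks a"] by (simp add: MMR_unit_def st_Nil qshuffle_Nil)
qed (rule biadditive_right[OF biadditive_MMR_mult], simp add: additive_def)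

lemma MMR_mult_unit_right: "MMR_mult x (MMR_unit 1) = x"
proof (rule additive_eqI[of "\<lambda>x. MMR_mult x (MMR_unit 1)" "\<lambda>x. x"])
  fix a show "MMR_mult (frag_of a) (MMR_unit 1) = frag_of a"
    using MMR_mult_st[of "blocks a" "[]"]
    by (simp add: MMR_unit_def st_Nil qshuffle_Nil qshuffle_commute[of _ "[]"])
qed (rule biadditive_left[OF biadditive_MMR_mult], simp add: additive_def)


section \<open>Cutting words and the coalgebra structure\<close>

abbreviation deconcatenations :: "nat set list \<Rightarrow> (nat set list \<times> nat set list) set" where
  "deconcatenations w \<equiv> {(u, v). u @ v = w}"

lemma sum_deconcatenations_map:
  "(\<Sum>(u, v)\<in>deconcatenations (map g w). f u v) = (\<Sum>(u, v)\<in>deconcatenations w. f (map g u) (map g v))"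
  \<comment> \<open>The cut is transported by its position: \<open>g\<close> may fail to be
    injective, so a prefix of \<open>w\<close> is found by its length instead of by inverting
    \<open>g\<close>.\<close>
  by (rule sum.reindex_bij_witness[where j = "\<lambda>(u, v). (take (length u) w, drop (length u) w)"
      and i = "\<lambda>(u, v). (map g u, map g v)"])
    (auto simp: append_eq_map_conv)

lemma deconcatenations_Nil: "deconcatenations [] = {([], [])}"
  by auto

lemma sum_deconcatenations_cong:
  assumes "\<And>u v. u @ v = w \<Longrightarrow> f u v = g u v"
  shows "(\<Sum>(u, v)\<in>deconcatenations w. f u v) = (\<Sum>(u, v)\<in>deconcatenations w. g u v)"
  by (rule sum.cong) (auto simp: assms)

lemma MMR_comult_frag_of:
  "MMR_comult (frag_of w) = (\<Sum>(u, v)\<in>deconcatenations (blocks w). frag_of (st u, st v))"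
  by (simp add: MMR_comult_def)

text \<open>The map that standardizes \<open>w\<close> also collapses each piece of a cut, and
  collapsing leaves the standardization of the piece unchanged.\<close>

lemma MMR_comult_st:
  assumes "scomp w"
  shows "MMR_comult (frag_of (st w)) = (\<Sum>(u, v)\<in>deconcatenations w. frag_of (st u, st v))"
proof -
  obtain f where f: "collapsing f w" "blocks (st w) = map ((`) f) w"
    using st_collapsing[OF assms] .
  have "st (map ((`) f) u) = st u \<and> st (map ((`) f) v) = st v" if "u @ v = w" for u v
    using assms that by (intro conjI st_collapse collapsing_subset[OF f(1)]) auto
  then show ?thesis
    unfolding MMR_comult_frag_of f(2) sum_deconcatenations_map by (intro sum.cong refl) auto
qed

lemma additive_MMR_comult: "additive MMR_comult"
  by (simp add: MMR_comult_def additive_frag_extend)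

lemma additive_MMR_counit: "additive MMR_counit"
  by (simp add: additive_def MMR_counit_def lookup_add)

lemma MMR_counit_frag_of: "MMR_counit (frag_of w) = (if w = empty_mperm then 1 else 0)"
  by (simp add: MMR_counit_def lookup_single when_def)

lemma additive_tensor_map: "additive (tensor_map f g)"
  and additive_tensor_assoc: "additive tensor_assoc"
  and additive_apply_left: "additive (apply_left e)"
  and additive_apply_right: "additive (apply_right e)"
  by (simp_all add: tensor_map_def tensor_assoc_def apply_left_def apply_right_def additive_frag_extend)

lemma tensor_assoc_frag_of: "tensor_assoc (frag_of ((a, b), c)) = frag_of (a, b, c)"
  by (simp add: tensor_assoc_def)

lemma tensor_sum_left: "tensor (sum f A) y = (\<Sum>a\<in>A. tensor (f a) y)"
  and tensor_sum_right: "tensor x (sum g B) = (\<Sum>b\<in>B. tensor x (g b))"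
  using additive.sum[OF biadditive_left[OF biadditive_tensor]]
    additive.sum[OF biadditive_right[OF biadditive_tensor]] by auto

text \<open>Both sides run over the ways of cutting \<open>w\<close> into three consecutive
  pieces.\<close>

lemma sum_deconcatenations_assoc:
  "(\<Sum>(u, v)\<in>deconcatenations w. \<Sum>(a, b)\<in>deconcatenations u. f a b v) =
   (\<Sum>(u, v)\<in>deconcatenations w. \<Sum>(a, b)\<in>deconcatenations v. f u a b)"
proof -
  have "(\<Sum>(u, v)\<in>deconcatenations w. \<Sum>(a, b)\<in>deconcatenations u. f a b v) =
      (\<Sum>((u, v), (a, b))\<in>(SIGMA p:deconcatenations w. deconcatenations (fst p)). f a b v)"
    unfolding case_prod_unfold
    by (subst sum.Sigma) (auto simp: finite_deconcatenations[unfolded case_prod_unfold] case_prod_unfold)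
  also have "\<dots> = (\<Sum>((u, v), (a, b))\<in>(SIGMA p:deconcatenations w. deconcatenations (snd p)). f u a b)"
    by (rule sum.reindex_bij_witness[where j = "\<lambda>((u, v), (a, b)). ((a, b @ v), (b, v))"
        and i = "\<lambda>((u, v), (a, b)). ((u @ a, b), (u, a))"]) auto
  also have "\<dots> = (\<Sum>(u, v)\<in>deconcatenations w. \<Sum>(a, b)\<in>deconcatenations v. f u a b)"
    unfolding case_prod_unfold
    by (subst sum.Sigma) (auto simp: finite_deconcatenations[unfolded case_prod_unfold] case_prod_unfold)
  finally show ?thesis .
qed

lemma MMR_comult_coassoc:
  "tensor_assoc (tensor_map MMR_comult id (MMR_comult x)) = tensor_map id MMR_comult (MMR_comult x)"
proof (rule additive_eqI[where x = x])
  show "additive (\<lambda>x. tensor_assoc (tensor_map MMR_comult id (MMR_comult x)))"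
    "additive (\<lambda>x. tensor_map id MMR_comult (MMR_comult x))"
    by (intro additive_o[OF additive_tensor_assoc] additive_o[OF additive_tensor_map] additive_MMR_comult)+
  fix w
  let ?D = "deconcatenations (blocks w)"
  have D: "scomp u" "scomp v" if "(u, v) \<in> ?D" for u v
    using scomp_blocks[of w] that by (metis (mono_tags) case_prodD mem_Collect_eq scomp_append)+
  have "tensor_assoc (tensor_map MMR_comult id (MMR_comult (frag_of w))) =
      (\<Sum>(u, v)\<in>?D. tensor_assoc (tensor (MMR_comult (frag_of (st u))) (frag_of (st v))))"
    unfolding MMR_comult_frag_of[of w] case_prod_unfold additive.sum[OF additive_tensor_map]
      additive.sum[OF additive_tensor_assoc] by (simp add: tensor_map_def)
  also have "\<dots> = (\<Sum>(u, v)\<in>?D. \<Sum>(a, b)\<in>deconcatenations u. frag_of (st a, st b, st v))"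
  proof (rule sum_deconcatenations_cong)
    fix u v assume "u @ v = blocks w"
    then have "scomp u" using D by auto
    then show "tensor_assoc (tensor (MMR_comult (frag_of (st u))) (frag_of (st v))) =
        (\<Sum>(a, b)\<in>deconcatenations u. frag_of (st a, st b, st v))"
      by (simp add: MMR_comult_st case_prod_unfold tensor_sum_left additive.sum[OF additive_tensor_assoc]
          tensor_assoc_frag_of)
  qed
  also have "\<dots> = (\<Sum>(u, v)\<in>?D. \<Sum>(a, b)\<in>deconcatenations v. frag_of (st u, st a, st b))"
    by (rule sum_deconcatenations_assoc)
  also have "\<dots> = (\<Sum>(u, v)\<in>?D. tensor (frag_of (st u)) (MMR_comult (frag_of (st v))))"
  proof (rule sum_deconcatenations_cong)
    fix u v assume "u @ v = blocks w"
    then have "scomp v" using D by auto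
    then show "(\<Sum>(a, b)\<in>deconcatenations v. frag_of (st u, st a, st b)) =
        tensor (frag_of (st u)) (MMR_comult (frag_of (st v)))"
      by (simp add: MMR_comult_st case_prod_unfold tensor_sum_right)
  qed
  also have "\<dots> = tensor_map id MMR_comult (MMR_comult (frag_of w))"
    unfolding MMR_comult_frag_of[of w] case_prod_unfold additive.sum[OF additive_tensor_map]
    by (simp add: tensor_map_def)
  finally show "tensor_assoc (tensor_map MMR_comult id (MMR_comult (frag_of w))) =
    tensor_map id MMR_comult (MMR_comult (frag_of w))" .
qed

lemma MMR_counit_left: "apply_left MMR_counit (MMR_comult x) = x"
proof (rule additive_eqI[of "\<lambda>x. apply_left MMR_counit (MMR_comult x)" "\<lambda>x. x"])
  show "additive (\<lambda>x. apply_left MMR_counit (MMR_comult x))"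
    by (intro additive_o[OF additive_apply_left] additive_MMR_comult)
  fix w
  let ?D = "deconcatenations (blocks w)"
  have "apply_left MMR_counit (MMR_comult (frag_of w)) =
      (\<Sum>(u, v)\<in>?D. frag_cmul (MMR_counit (frag_of (st u))) (frag_of (st v)))"
    unfolding MMR_comult_frag_of[of w] case_prod_unfold additive.sum[OF additive_apply_left]
    by (simp add: apply_left_def)
  \<comment> \<open>The counit vanishes unless \<open>u\<close> is empty, so a single cut
    survives.\<close>
  also have "\<dots> = (\<Sum>(u, v)\<in>?D. if (u, v) = ([], blocks w) then frag_of w else 0)"
  proof (rule sum_deconcatenations_cong)
    fix u v assume eq: "u @ v = blocks w"
    then have "scomp u" by (metis scomp_append scomp_blocks)
    with eq st_blocks[of w] show "frag_cmul (MMR_counit (frag_of (st u))) (frag_of (st v)) =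
        (if (u, v) = ([], blocks w) then frag_of w else 0)"
      by (auto simp: MMR_counit_frag_of st_eq_empty_iff)
  qed
  also have "\<dots> = frag_of w"
    unfolding case_prod_unfold prod.collapse
    using finite_deconcatenations[of "blocks w"] by (simp add: case_prod_unfold)
  finally show "apply_left MMR_counit (MMR_comult (frag_of w)) = frag_of w" .
qed (simp add: additive_def)

lemma MMR_counit_right: "apply_right MMR_counit (MMR_comult x) = x"
proof (rule additive_eqI[of "\<lambda>x. apply_right MMR_counit (MMR_comult x)" "\<lambda>x. x"])
  show "additive (\<lambda>x. apply_right MMR_counit (MMR_comult x))"
    by (intro additive_o[OF additive_apply_right] additive_MMR_comult)
  fix w
  let ?D = "deconcatenations (blocks w)"
  have "apply_right MMR_counit (MMR_comult (frag_of w)) =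
      (\<Sum>(u, v)\<in>?D. frag_cmul (MMR_counit (frag_of (st v))) (frag_of (st u)))"
    unfolding MMR_comult_frag_of[of w] case_prod_unfold additive.sum[OF additive_apply_right]
    by (simp add: apply_right_def)
  also have "\<dots> = (\<Sum>(u, v)\<in>?D. if (u, v) = (blocks w, []) then frag_of w else 0)"
  proof (rule sum_deconcatenations_cong)
    fix u v assume eq: "u @ v = blocks w"
    then have "scomp v" by (metis scomp_append scomp_blocks)
    with eq st_blocks[of w] show "frag_cmul (MMR_counit (frag_of (st v))) (frag_of (st u)) =
        (if (u, v) = (blocks w, []) then frag_of w else 0)"
      by (auto simp: MMR_counit_frag_of st_eq_empty_iff)
  qed
  also have "\<dots> = frag_of w"
    unfolding case_prod_unfold prod.collapse
    using finite_deconcatenations[of "blocks w"] by (simp add: case_prod_unfold)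
  finally show "apply_right MMR_counit (MMR_comult (frag_of w)) = frag_of w" .
qed (simp add: additive_def)

section \<open>Compatibility of product and coproduct\<close>

lemma tensor_mult_frag_of:
  "tensor_mult m (frag_of (a, b)) (frag_of (c, d)) = tensor (m (frag_of a) (frag_of c)) (m (frag_of b) (frag_of d))"
  by (simp add: tensor_mult_def)

lemma tensor_mult_sum:
  "tensor_mult m (sum f A) (sum g B) = (\<Sum>a\<in>A. \<Sum>b\<in>B. tensor_mult m (f a) (g b))"
  unfolding additive.sum[OF biadditive_left[OF biadditive_tensor_mult]]
  unfolding additive.sum[OF biadditive_right[OF biadditive_tensor_mult]] ..

text \<open>A cut \<open>a @ b\<close> of a quasi-shuffle induces cuts of \<open>w\<close> and
  \<open>u\<close> by restriction, with \<open>a\<close> and \<open>b\<close> quasi-shuffles of the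
  corresponding pieces. Conversely, quasi-shuffles of the pieces concatenate. Disjointness of the
  letters ensures that the pieces can be read off from \<open>a\<close> and
  \<open>b\<close>.\<close>

lemma sum_qshuffle_deconcatenations:
  assumes w: "scomp w" and u: "scomp u" and disj: "letters w \<inter> letters u = {}"
  shows "(\<Sum>v\<in>qshuffle w u. \<Sum>(a, b)\<in>deconcatenations v. f a b) =
    (\<Sum>(w1, w2)\<in>deconcatenations w. \<Sum>(u1, u2)\<in>deconcatenations u.
      \<Sum>a\<in>qshuffle w1 u1. \<Sum>b\<in>qshuffle w2 u2. f a b)"
proof -
  have fin: "finite (qshuffle (fst p) (fst q) \<times> qshuffle (snd p) (snd q))"
    if "p \<in> deconcatenations w" "q \<in> deconcatenations u" for p q
    using w u that by (intro finite_cartesian_product finite_qshuffle) auto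
  define R where "R = (SIGMA p:deconcatenations w. SIGMA q:deconcatenations u.
    qshuffle (fst p) (fst q) \<times> qshuffle (snd p) (snd q))"
  have "(\<Sum>v\<in>qshuffle w u. \<Sum>(a, b)\<in>deconcatenations v. f a b) =
      (\<Sum>(v, (a, b))\<in>(SIGMA v:qshuffle w u. deconcatenations v). f a b)"
    by (intro sum.Sigma finite_qshuffle w u ballI finite_deconcatenations)
  also have "\<dots> = (\<Sum>(p, q, a, b)\<in>R. f a b)"
  proof (rule sum.reindex_bij_witness[where
        j = "\<lambda>(v, a, b). ((restr a (letters w), restr b (letters w)), (restr a (letters u), restr b (letters u)), a, b)"
        and i = "\<lambda>(p, q, a, b). (a @ b, a, b)"])
    fix x assume x: "x \<in> (SIGMA v:qshuffle w u. deconcatenations v)"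
    then obtain a b where ab: "x = (a @ b, a, b)" "a @ b \<in> qshuffle w u"
      by auto
    let ?j = "\<lambda>(v, a, b). ((restr a (letters w), restr b (letters w)), (restr a (letters u), restr b (letters u)), a, b)"
    show "(\<lambda>(p, q, a, b). (a @ b, a, b)) (?j x) = x"
      "(case ?j x of (p, q, a, b) \<Rightarrow> f a b) = (case x of (v, a, b) \<Rightarrow> f a b)"
      using ab by simp_all
    have v: "scomp (a @ b)" "letters a \<union> letters b = letters w \<union> letters u"
      "restr a (letters w) @ restr b (letters w) = w" "restr a (letters u) @ restr b (letters u) = u"
      using ab(2) by (auto simp: qshuffle_def)
    \<comment> \<open>Any composition of letters of \<open>w\<close> and \<open>u\<close> is a
      quasi-shuffle of its own two restrictions.\<close>
    have q: "c \<in> qshuffle (restr c (letters w)) (restr c (letters u))"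
      if "scomp c" "letters c \<subseteq> letters w \<union> letters u" for c
      unfolding qshuffle_def letters_restr
    proof (intro CollectI conjI that(1))
      show "letters c = letters c \<inter> letters w \<union> letters c \<inter> letters u"
        using that(2) by blast
      show "restr c (letters c \<inter> letters w) = restr c (letters w)"
        "restr c (letters c \<inter> letters u) = restr c (letters u)"
        by (rule restr_cong, blast)+
    qed
    have "a \<in> qshuffle (restr a (letters w)) (restr a (letters u))"
      "b \<in> qshuffle (restr b (letters w)) (restr b (letters u))"
      using v(1,2) by (intro q; simp; blast)+
    then show "?j x \<in> R"
      using v(3,4) ab(1) by (simp add: R_def)
  next
    fix x assume "x \<in> R"
    then obtain w1 w2 u1 u2 a b where x: "x = ((w1, w2), (u1, u2), a, b)" "w1 @ w2 = w" "u1 @ u2 = u"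
      "a \<in> qshuffle w1 u1" "b \<in> qshuffle w2 u2"
      by (auto simp: R_def)
    let ?i = "\<lambda>(p, q, a, b). (a @ b, a, b)"
    have a: "scomp a" "letters a = letters w1 \<union> letters u1" "restr a (letters w1) = w1" "restr a (letters u1) = u1"
      and b: "scomp b" "letters b = letters w2 \<union> letters u2" "restr b (letters w2) = w2" "restr b (letters u2) = u2"
      using x(4,5) by (simp_all add: qshuffle_def)
    have dw: "letters w = letters w1 \<union> letters w2" "letters w1 \<inter> letters w2 = {}"
      and du: "letters u = letters u1 \<union> letters u2" "letters u1 \<inter> letters u2 = {}"
      using w u unfolding x(2,3)[symmetric] scomp_append by simp_all
    \<comment> \<open>The sets stand for the letters of \<open>w1\<close>, \<open>w2\<close>,
      \<open>u1\<close>, \<open>u2\<close> in this order; thus \<open>a\<close> has letters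
      \<open>A \<union> C\<close> and \<open>b\<close> has letters
      \<open>B \<union> D\<close>.\<close>
    have Int: "(A \<union> C) \<inter> (A \<union> B) = (A \<union> C) \<inter> A" "(A \<union> C) \<inter> (C \<union> D) = (A \<union> C) \<inter> C"
      "(B \<union> D) \<inter> (A \<union> B) = (B \<union> D) \<inter> B" "(B \<union> D) \<inter> (C \<union> D) = (B \<union> D) \<inter> D"
      "(A \<union> C) \<inter> (B \<union> D) = {}"
      if "(A \<union> B) \<inter> (C \<union> D) = {}" "A \<inter> B = {}" "C \<inter> D = {}" for A B C D :: "nat set"
      using that by blast+
    note Int = Int[OF disj[unfolded dw(1) du(1)] dw(2) du(2)]
    have "letters a \<inter> letters w = letters a \<inter> letters w1" "letters a \<inter> letters u = letters a \<inter> letters u1"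
      "letters b \<inter> letters w = letters b \<inter> letters w2" "letters b \<inter> letters u = letters b \<inter> letters u2"
      unfolding a(2) b(2) dw(1) du(1) by (rule Int)+
    then have r: "restr a (letters w) = w1" "restr a (letters u) = u1"
      "restr b (letters w) = w2" "restr b (letters u) = u2"
      using a(3,4) b(3,4) restr_cong by metis+
    then show "(\<lambda>(v, a, b). ((restr a (letters w), restr b (letters w)), (restr a (letters u), restr b (letters u)), a, b)) (?i x) = x"
      using x(1) by simp
    have "scomp (a @ b)"
      unfolding scomp_append a(2) b(2) by (intro conjI a(1) b(1) Int)
    moreover have "letters (a @ b) = letters w \<union> letters u"
      unfolding dw du set_append Union_Un_distrib a(2) b(2) by (simp only: Un_ac)
    ultimately have "a @ b \<in> qshuffle w u"
      using r x(2,3) by (simp add: qshuffle_def)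
    then show "?i x \<in> (SIGMA v:qshuffle w u. deconcatenations v)"
      using x(1) by simp
  qed
  also have "\<dots> = (\<Sum>p\<in>deconcatenations w. \<Sum>(q, a, b)\<in>(SIGMA q:deconcatenations u.
      qshuffle (fst p) (fst q) \<times> qshuffle (snd p) (snd q)). f a b)"
    unfolding R_def
    by (intro sum.Sigma[symmetric] ballI finite_SigmaI finite_deconcatenations fin)
  also have "\<dots> = (\<Sum>p\<in>deconcatenations w. \<Sum>q\<in>deconcatenations u.
      \<Sum>(a, b)\<in>qshuffle (fst p) (fst q) \<times> qshuffle (snd p) (snd q). f a b)"
    by (intro sum.cong refl sum.Sigma[symmetric] ballI finite_deconcatenations fin)
  also have "\<dots> = (\<Sum>(w1, w2)\<in>deconcatenations w. \<Sum>(u1, u2)\<in>deconcatenations u.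
      \<Sum>a\<in>qshuffle w1 u1. \<Sum>b\<in>qshuffle w2 u2. f a b)"
    by (simp add: sum.cartesian_product case_prod_unfold)
  finally show ?thesis .
qed

text \<open>With separated representatives, all letters of a piece of \<open>w\<close> still lie
  below those of a piece of \<open>u\<close>. So the quasi-shuffle sums over pieces are again
  products, one in each tensor factor.\<close>

lemma MMR_comult_mult_frag_of:
  "MMR_comult (MMR_mult (frag_of x) (frag_of y)) =
    tensor_mult MMR_mult (MMR_comult (frag_of x)) (MMR_comult (frag_of y))"
proof -
  obtain w where w: "scomp w" "st w = x"
    using scomp_shifted[of 0 x] by blast
  obtain m where m: "letters w \<subseteq> {..m}"
    using finite_subset_atMost scomp_finite[OF w(1)] by blast
  obtain u where u: "scomp u" "letters u \<subseteq> {m<..}" "st u = y"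
    using scomp_shifted[of m y] by blast
  have less: "a < b" if "a \<in> letters w" "b \<in> letters u" for a b
    using subsetD[OF m that(1)] subsetD[OF u(2) that(2)] by simp
  have disj: "letters w \<inter> letters u = {}"
    using m u(2) by fastforce
  have "MMR_comult (MMR_mult (frag_of x) (frag_of y)) = (\<Sum>v\<in>qshuffle w u. MMR_comult (frag_of (st v)))"
    using MMR_mult_st[OF w(1) u(1) less] w(2) u(3) by (simp add: additive.sum[OF additive_MMR_comult])
  also have "\<dots> = (\<Sum>v\<in>qshuffle w u. \<Sum>(a, b)\<in>deconcatenations v. frag_of (st a, st b))"
    by (intro sum.cong refl MMR_comult_st) (rule qshuffle_scomp)
  also have "\<dots> = (\<Sum>(w1, w2)\<in>deconcatenations w. \<Sum>(u1, u2)\<in>deconcatenations u.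
      \<Sum>a\<in>qshuffle w1 u1. \<Sum>b\<in>qshuffle w2 u2. frag_of (st a, st b))"
    by (rule sum_qshuffle_deconcatenations[OF w(1) u(1) disj])
  also have "\<dots> = (\<Sum>(w1, w2)\<in>deconcatenations w. \<Sum>(u1, u2)\<in>deconcatenations u.
      tensor_mult MMR_mult (frag_of (st w1, st w2)) (frag_of (st u1, st u2)))"
  proof (intro sum_deconcatenations_cong)
    fix w1 w2 u1 u2 assume w': "w1 @ w2 = w" and u': "u1 @ u2 = u"
    have s: "scomp w1" "scomp w2" "scomp u1" "scomp u2"
      using w(1) u(1) unfolding w'[symmetric] u'[symmetric] by simp_all
    have "MMR_mult (frag_of (st w1)) (frag_of (st u1)) = (\<Sum>v\<in>qshuffle w1 u1. frag_of (st v))"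
      "MMR_mult (frag_of (st w2)) (frag_of (st u2)) = (\<Sum>v\<in>qshuffle w2 u2. frag_of (st v))"
      by (intro MMR_mult_st s less; simp add: w'[symmetric] u'[symmetric])+
    then show "(\<Sum>a\<in>qshuffle w1 u1. \<Sum>b\<in>qshuffle w2 u2. frag_of (st a, st b)) =
        tensor_mult MMR_mult (frag_of (st w1, st w2)) (frag_of (st u1, st u2))"
      by (simp only: tensor_mult_frag_of tensor_sum_left) (simp add: tensor_sum_right)
  qed
  also have "\<dots> = tensor_mult MMR_mult (MMR_comult (frag_of x)) (MMR_comult (frag_of y))"
    using MMR_comult_st[OF w(1)] MMR_comult_st[OF u(1)] w(2) u(3)
    by (simp add: tensor_mult_sum case_prod_unfold)
  finally show ?thesis .
qed

lemma MMR_comult_mult: "MMR_comult (MMR_mult x y) = tensor_mult MMR_mult (MMR_comult x) (MMR_comult y)"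
proof (rule biadditive_eqI[of "\<lambda>x y. MMR_comult (MMR_mult x y)"
      "\<lambda>x y. tensor_mult MMR_mult (MMR_comult x) (MMR_comult y)"])
  note m = biadditive_left[OF biadditive_MMR_mult] biadditive_right[OF biadditive_MMR_mult]
  note t = biadditive_left[OF biadditive_tensor_mult] biadditive_right[OF biadditive_tensor_mult]
  show "biadditive (\<lambda>x y. MMR_comult (MMR_mult x y))"
    unfolding biadditive_def by (intro conjI allI additive_o[OF additive_MMR_comult] m)
  show "biadditive (\<lambda>x y. tensor_mult MMR_mult (MMR_comult x) (MMR_comult y))"
    unfolding biadditive_def
    by (intro conjI allI additive_o[OF t(1) additive_MMR_comult] additive_o[OF t(2) additive_MMR_comult])
qed (rule MMR_comult_mult_frag_of)

lemma MMR_counit_mult: "MMR_counit (MMR_mult x y) = MMR_counit x * MMR_counit y"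
proof (rule biadditive_eqI[of "\<lambda>x y. MMR_counit (MMR_mult x y)" "\<lambda>x y. MMR_counit x * MMR_counit y"])
  note m = biadditive_left[OF biadditive_MMR_mult] biadditive_right[OF biadditive_MMR_mult]
  show "biadditive (\<lambda>x y. MMR_counit (MMR_mult x y))"
    unfolding biadditive_def by (intro conjI allI additive_o[OF additive_MMR_counit] m)
  show "biadditive (\<lambda>x y. MMR_counit x * MMR_counit y)"
    unfolding biadditive_def additive_def additive.add[OF additive_MMR_counit] by (simp add: algebra_simps)
  fix a b
  \<comment> \<open>In \<open>prod_terms_iff\<close> degree 0 forces \<open>c = 0\<close> and
    \<open>deg b = 0\<close>, which excludes the alternative with \<open>deg b \<noteq> 0\<close>
    and leaves \<open>deg a = 0\<close>.\<close>
  have "empty_mperm \<in> prod_terms a b \<longleftrightarrow> a = empty_mperm \<and> b = empty_mperm"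
    using letters_blocks[of empty_mperm] blocks_inject[of a empty_mperm] st_Nil
    by (auto simp: prod_terms_iff deg_def)
  then show "MMR_counit (MMR_mult (frag_of a) (frag_of b)) = MMR_counit (frag_of a) * MMR_counit (frag_of b)"
    by (simp add: MMR_mult_frag_of additive.sum[OF additive_MMR_counit] MMR_counit_frag_of finite_prod_terms)
qed

theorem theorem7p5:
  shows "Z_bialgebra MMR_mult MMR_unit MMR_comult MMR_counit"
proof (intro Z_bialgebra.intro Z_algebra.intro Z_coalgebra.intro Z_bialgebra_axioms.intro)
  show "biadditive MMR_mult"
    by (rule biadditive_MMR_mult)
  show "additive MMR_unit"
    by (simp add: additive_def MMR_unit_def frag_cmul_distrib)
  show "additive MMR_comult" "additive MMR_counit"
    by (rule additive_MMR_comult additive_MMR_counit)+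
  show "MMR_comult (MMR_unit 1) = tensor (MMR_unit 1) (MMR_unit 1)"
    by (simp add: MMR_unit_def MMR_comult_frag_of st_Nil deconcatenations_Nil)
  show "MMR_counit (MMR_unit 1) = 1"
    by (simp add: MMR_unit_def MMR_counit_frag_of)
qed (rule MMR_mult_assoc MMR_mult_unit_left MMR_mult_unit_right MMR_comult_coassoc
    MMR_counit_left MMR_counit_right MMR_comult_mult MMR_counit_mult)+

end
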